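(* Let $p\ge1$, let $A\in L^{2p}(\mathbb R)^{2\times2}$, and let $\lambda\in\varrho(H_0)$. Then the operator $A\,(H_0-\lambda)^{-1}$ is compact in $L^2(\mathbb R)^2$ (where $A$ denotes the operator of multiplication with the matrix-valued function $A$).
   Context: Setting: $m\ge0$, $a>0$, and $q:\mathbb R\to\mathbb R$ is locally integrable and $a$-periodic. Pauli matrices: $\sigma_2=\begin{pmatrix}0&-i\\i&0\end{pmatrix}$, $\sigma_3=\begin{pmatrix}1&0\\0&-1\end{pmatrix}$. $H_0=-i\sigma_2\frac d{dx}+m\sigma_3+q$ is the self-adjoint operator in $L^2(\mathbb R)^2$ (on its maximal domain), with resolvent set $\varrho(H_0)$. $A\in L^{2p}(\mathbb R)^{2\times2}$ means that $A:\mathbb R\to\mathbb C^{2\times2}$ is measurable with $\int_{\mathbb R}\|A(x)\|^{2p}\,dx<\infty$, where $\|A(x)\|$ is the operator norm of the matrix $A(x)$. *)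

theory Defs
  imports "HOL-Analysis.Analysis"
begin

section \<open>The Hilbert space $L^2(\mathbb{R})^2$\<close>

definition square_integrable :: "(real \<Rightarrow> complex^2) set" where
  "square_integrable =
     {u \<in> borel_measurable lebesgue. integrable lebesgue (\<lambda>x. (norm (u x))\<^sup>2)}"

lemma square_integrableD:
  assumes "u \<in> square_integrable"
  shows "u \<in> borel_measurable lebesgue" "integrable lebesgue (\<lambda>x. (norm (u x))\<^sup>2)"
  using assms by (auto simp: square_integrable_def)

lemma square_integrable_zero: "(\<lambda>x. 0) \<in> square_integrable"
  by (simp add: square_integrable_def)

lemma square_integrable_add:
  assumes u: "u \<in> square_integrable" and v: "v \<in> square_integrable"
  shows "(\<lambda>x. u x + v x) \<in> square_integrable"
proof -
  note [measurable] = square_integrableD(1)[OF u] square_integrableD(1)[OF v]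
  have "integrable lebesgue (\<lambda>x. (norm (u x + v x))\<^sup>2)"
  proof (rule Bochner_Integration.integrable_bound)
    show "integrable lebesgue (\<lambda>x. 2 * (norm (u x))\<^sup>2 + 2 * (norm (v x))\<^sup>2)"
      using square_integrableD(2)[OF u] square_integrableD(2)[OF v] by simp
    have "(norm (u x + v x))\<^sup>2 \<le> 2 * (norm (u x))\<^sup>2 + 2 * (norm (v x))\<^sup>2" for x
    proof -
      have "(norm (u x + v x))\<^sup>2 \<le> (norm (u x) + norm (v x))\<^sup>2"
        by (intro power_mono norm_triangle_ineq norm_ge_zero)
      also have "\<dots> \<le> 2 * (norm (u x))\<^sup>2 + 2 * (norm (v x))\<^sup>2"
        using sum_squares_bound[of "norm (u x)" "norm (v x)"] by (simp add: power2_sum)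
      finally show ?thesis .
    qed
    then show "AE x in lebesgue. norm ((norm (u x + v x))\<^sup>2)
        \<le> norm (2 * (norm (u x))\<^sup>2 + 2 * (norm (v x))\<^sup>2)"
      by (intro AE_I2) fastforce
  qed measurable
  then show ?thesis by (simp add: square_integrable_def)
qed

lemma square_integrable_scaleR:
  assumes u: "u \<in> square_integrable"
  shows "(\<lambda>x. r *\<^sub>R u x) \<in> square_integrable"
  using square_integrableD[OF u]
  by (auto simp: square_integrable_def power_mult_distrib)

lemma norm_vector_scalar_mult: "norm (c *s z) = norm c * norm (z :: complex^'n)"
  by (simp add: norm_vec_def vector_scalar_mult_def norm_mult L2_set_right_distrib)

lemma square_integrable_scaleC:
  assumes u: "u \<in> square_integrable"
  shows "(\<lambda>x. c *s u x) \<in> square_integrable"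
proof -
  have "continuous_on UNIV ((*s) c :: complex^2 \<Rightarrow> complex^2)"
    unfolding vector_scalar_mult_def by (intro continuous_intros)
  then have "(\<lambda>x. c *s u x) \<in> borel_measurable lebesgue"
    using square_integrableD(1)[OF u] borel_measurable_continuous_on by blast
  then show ?thesis
    using square_integrableD(2)[OF u]
    by (auto simp: square_integrable_def norm_vector_scalar_mult power_mult_distrib)
qed

lemma square_integrable_inner:
  assumes u: "u \<in> square_integrable" and v: "v \<in> square_integrable"
  shows "integrable lebesgue (\<lambda>x. u x \<bullet> v x)"
proof -
  note [measurable] = square_integrableD(1)[OF u] square_integrableD(1)[OF v]
  show ?thesis
  proof (rule Bochner_Integration.integrable_bound)
    show "integrable lebesgue (\<lambda>x. (norm (u x))\<^sup>2 + (norm (v x))\<^sup>2)"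
      using square_integrableD(2)[OF u] square_integrableD(2)[OF v] by simp
    have "\<bar>u x \<bullet> v x\<bar> \<le> (norm (u x))\<^sup>2 + (norm (v x))\<^sup>2" for x
    proof -
      have "\<bar>u x \<bullet> v x\<bar> \<le> norm (u x) * norm (v x)" by (rule Cauchy_Schwarz_ineq2)
      also have "\<dots> \<le> 2 * norm (u x) * norm (v x)" by simp
      also have "\<dots> \<le> (norm (u x))\<^sup>2 + (norm (v x))\<^sup>2" by (rule sum_squares_bound)
      finally show ?thesis .
    qed
    then show "AE x in lebesgue. norm (u x \<bullet> v x) \<le> norm ((norm (u x))\<^sup>2 + (norm (v x))\<^sup>2)"
      by (intro AE_I2) fastforce
  qed measurable
qed

quotient_type L2 = "real \<Rightarrow> complex^2" / partial:
  "\<lambda>u v. u \<in> square_integrable \<and> v \<in> square_integrable \<and> (AE x in lebesgue. u x = v x)"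
proof (rule part_equivpI)
  show "\<exists>u. u \<in> square_integrable \<and> u \<in> square_integrable \<and>
      (AE x in lebesgue. (u :: real \<Rightarrow> complex^2) x = u x)"
    using square_integrable_zero by auto
  show "symp (\<lambda>u v. u \<in> square_integrable \<and> v \<in> square_integrable \<and>
      (AE x in lebesgue. u x = v x))"
    by (auto intro!: sympI elim: AE_mp)
  show "transp (\<lambda>u v. u \<in> square_integrable \<and> v \<in> square_integrable \<and>
      (AE x in lebesgue. u x = v x))"
    by (auto intro!: transpI elim: AE_mp)
qed

text \<open>The real inner product below is the real part of the usual complex one; it induces the
  usual $L^2$ norm. Multiplication by complex scalars is added as \<open>scaleC\<close>.\<close>

instantiation L2 :: real_inner
begin

lift_definition zero_L2 :: L2 is "\<lambda>x. 0"
  by (simp add: square_integrable_zero)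

lift_definition plus_L2 :: "L2 \<Rightarrow> L2 \<Rightarrow> L2" is "\<lambda>u v x. u x + v x"
  by (auto simp: square_integrable_add elim: AE_mp)

lift_definition scaleR_L2 :: "real \<Rightarrow> L2 \<Rightarrow> L2" is "\<lambda>r u x. r *\<^sub>R u x"
  by (auto simp: square_integrable_scaleR elim: AE_mp)

definition uminus_L2 :: "L2 \<Rightarrow> L2" where "uminus_L2 f = (-1) *\<^sub>R f"

definition minus_L2 :: "L2 \<Rightarrow> L2 \<Rightarrow> L2" where "minus_L2 f g = f + (- g)"

lift_definition inner_L2 :: "L2 \<Rightarrow> L2 \<Rightarrow> real" is "\<lambda>u v. LINT x|lebesgue. u x \<bullet> v x"
proof -
  fix u1 u2 v1 v2 :: "real \<Rightarrow> complex^2"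
  assume u: "u1 \<in> square_integrable \<and> u2 \<in> square_integrable \<and> (AE x in lebesgue. u1 x = u2 x)"
    and v: "v1 \<in> square_integrable \<and> v2 \<in> square_integrable \<and> (AE x in lebesgue. v1 x = v2 x)"
  show "(LINT x|lebesgue. u1 x \<bullet> v1 x) = (LINT x|lebesgue. u2 x \<bullet> v2 x)"
  proof (rule integral_cong_AE)
    show "(\<lambda>x. u1 x \<bullet> v1 x) \<in> borel_measurable lebesgue"
      "(\<lambda>x. u2 x \<bullet> v2 x) \<in> borel_measurable lebesgue"
      using square_integrable_inner[of u1 v1] square_integrable_inner[of u2 v2] u v by auto
    show "AE x in lebesgue. u1 x \<bullet> v1 x = u2 x \<bullet> v2 x"
      using u v by (auto elim!: AE_mp)
  qed
qed

definition norm_L2 :: "L2 \<Rightarrow> real" where "norm_L2 f = sqrt (f \<bullet> f)"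

definition dist_L2 :: "L2 \<Rightarrow> L2 \<Rightarrow> real" where "dist_L2 f g = norm (f - g)"

definition sgn_L2 :: "L2 \<Rightarrow> L2" where "sgn_L2 f = inverse (norm f) *\<^sub>R f"

definition uniformity_L2 :: "(L2 \<times> L2) filter" where
  "uniformity_L2 = (INF e\<in>{0 <..}. principal {(f, g). dist f g < e})"

definition open_L2 :: "L2 set \<Rightarrow> bool" where
  "open_L2 U \<longleftrightarrow> (\<forall>f\<in>U. eventually (\<lambda>(f', g). f' = f \<longrightarrow> g \<in> U) uniformity)"

instance
proof
  fix f g h :: L2 and r s :: real
  show "f + g + h = f + (g + h)"
    by transfer (auto simp: square_integrable_add add.assoc)
  show "f + g = g + f"
    by transfer (auto simp: square_integrable_add add.commute)
  show "0 + f = f"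
    by transfer auto
  show "- f + f = 0"
    unfolding uminus_L2_def
    by transfer (auto simp: square_integrable_zero square_integrable_add
        square_integrable_scaleR[of _ "-1", simplified])
  show "f - g = f + - g"
    by (rule minus_L2_def)
  show "r *\<^sub>R (f + g) = r *\<^sub>R f + r *\<^sub>R g"
    by transfer (auto simp: square_integrable_add square_integrable_scaleR scaleR_add_right)
  show "(r + s) *\<^sub>R f = r *\<^sub>R f + s *\<^sub>R f"
    by transfer (auto simp: square_integrable_add square_integrable_scaleR scaleR_add_left)
  show "r *\<^sub>R s *\<^sub>R f = (r * s) *\<^sub>R f"
    by transfer (auto simp: square_integrable_scaleR)
  show "1 *\<^sub>R f = f"
    by transfer auto
  show "dist f g = norm (f - g)" "sgn f = inverse (norm f) *\<^sub>R f" "norm f = sqrt (f \<bullet> f)"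
    by (simp_all add: dist_L2_def sgn_L2_def norm_L2_def)
  show "uniformity = (INF e\<in>{0 <..}. principal {(f, g :: L2). dist f g < e})"
    by (rule uniformity_L2_def)
  show "open U \<longleftrightarrow> (\<forall>f\<in>U. \<forall>\<^sub>F (f', g) in uniformity. f' = f \<longrightarrow> g \<in> U)" for U :: "L2 set"
    by (rule open_L2_def)
  show "f \<bullet> g = g \<bullet> f"
    by transfer (simp add: inner_commute)
  show "(f + g) \<bullet> h = f \<bullet> h + g \<bullet> h"
    by transfer (simp add: inner_add_left square_integrable_inner)
  show "(r *\<^sub>R f) \<bullet> g = r * (f \<bullet> g)"
    by transfer simp
  show "0 \<le> f \<bullet> f"
    by transfer (simp add: integral_nonneg_AE)
  show "f \<bullet> f = 0 \<longleftrightarrow> f = 0"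
  proof transfer
    fix u :: "real \<Rightarrow> complex^2"
    assume "u \<in> square_integrable \<and> u \<in> square_integrable \<and> (AE x in lebesgue. u x = u x)"
    then have u: "u \<in> square_integrable" by simp
    have "(LINT x|lebesgue. u x \<bullet> u x) = 0 \<longleftrightarrow> (AE x in lebesgue. u x \<bullet> u x = 0)"
      by (rule integral_nonneg_eq_0_iff_AE) (simp_all add: square_integrable_inner u)
    then show "(LINT x|lebesgue. u x \<bullet> u x) = 0 \<longleftrightarrow>
        u \<in> square_integrable \<and> (\<lambda>x. 0) \<in> square_integrable \<and> (AE x in lebesgue. u x = 0)"
      using u by (simp add: square_integrable_zero)
  qed
qed

end

lift_definition scaleC :: "complex \<Rightarrow> L2 \<Rightarrow> L2" is "\<lambda>c u x. c *s u x"
  by (auto simp: square_integrable_scaleC elim: AE_mp)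

lemma norm_abs_L2:
  assumes u: "u \<in> square_integrable"
  shows "norm (abs_L2 u) = sqrt (LINT x|lebesgue. (norm (u x))\<^sup>2)"
proof -
  have "abs_L2 u \<bullet> abs_L2 u = (LINT x|lebesgue. u x \<bullet> u x)"
    by (rule inner_L2.abs_eq) (simp_all add: u)
  then show ?thesis
    by (simp add: norm_L2_def power2_norm_eq_inner)
qed


section \<open>Linear operators in $L^2(\mathbb{R})^2$\<close>

text \<open>A possibly unbounded operator is identified with its graph. With this convention the inverse
  of \<open>G\<close> is the converse relation, and the composition that applies \<open>G\<close> first and \<open>F\<close> second
  (usually written $FG$) is \<open>G O F\<close>.\<close>

definition linear_operator :: "(L2 \<times> L2) set \<Rightarrow> bool" where
  "linear_operator G \<longleftrightarrow> single_valued G \<and> subspace G \<and>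
     (\<forall>c f g. (f, g) \<in> G \<longrightarrow> (scaleC c f, scaleC c g) \<in> G)"

definition bounded_operator :: "(L2 \<times> L2) set \<Rightarrow> bool" where
  "bounded_operator G \<longleftrightarrow> linear_operator G \<and> Domain G = UNIV \<and>
     (\<exists>C. \<forall>f g. (f, g) \<in> G \<longrightarrow> norm g \<le> C * norm f)"

definition compact_operator :: "(L2 \<times> L2) set \<Rightarrow> bool" where
  "compact_operator G \<longleftrightarrow> linear_operator G \<and> Domain G = UNIV \<and>
     compact (closure (G `` cball 0 1))"

definition minus_scalar :: "(L2 \<times> L2) set \<Rightarrow> complex \<Rightarrow> (L2 \<times> L2) set" where
  "minus_scalar H z = {(f, g - scaleC z f) | f g. (f, g) \<in> H}"

definition resolvent :: "(L2 \<times> L2) set \<Rightarrow> complex \<Rightarrow> (L2 \<times> L2) set" where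
  "resolvent H z = (minus_scalar H z)\<inverse>"

definition resolvent_set :: "(L2 \<times> L2) set \<Rightarrow> complex set" where
  "resolvent_set H = {z. linear_operator (minus_scalar H z) \<and> bounded_operator (resolvent H z)}"


section \<open>The periodic Dirac operator\<close>

definition locally_integrable :: "(real \<Rightarrow> real) \<Rightarrow> bool" where
  "locally_integrable q \<longleftrightarrow> (\<forall>s t. q absolutely_integrable_on {s..t})"

definition absolutely_continuous_on ::
  "real set \<Rightarrow> (real \<Rightarrow> 'b::real_normed_vector) \<Rightarrow> bool" where
  "absolutely_continuous_on S u \<longleftrightarrow>
     (\<forall>\<epsilon>>0. \<exists>\<delta>>0. \<forall>D T. D division_of T \<and> T \<subseteq> S \<and> (\<Sum>K\<in>D. measure lborel K) < \<delta> \<longrightarrow>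
        (\<Sum>K\<in>D. norm (u (Sup K) - u (Inf K))) < \<epsilon>)"

definition locally_absolutely_continuous :: "(real \<Rightarrow> 'b::real_normed_vector) \<Rightarrow> bool" where
  "locally_absolutely_continuous u \<longleftrightarrow> (\<forall>s t. absolutely_continuous_on {s..t} u)"

definition \<sigma>\<^sub>2 :: "complex^2^2" where
  "\<sigma>\<^sub>2 = vector [vector [0, - \<i>], vector [\<i>, 0]]"

definition \<sigma>\<^sub>3 :: "complex^2^2" where
  "\<sigma>\<^sub>3 = vector [vector [1, 0], vector [0, -1]]"

text \<open>The maximal domain consists of all $L^2$ functions that have a locally absolutely continuous
  representative \<open>u\<close> for which the differential expression, evaluated with the almost everywhere
  existing derivative \<open>u'\<close> of \<open>u\<close>, is again in $L^2$.\<close>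

definition dirac :: "real \<Rightarrow> (real \<Rightarrow> real) \<Rightarrow> (L2 \<times> L2) set" where
  "dirac m q = {(abs_L2 u, abs_L2 v) | u v.
     u \<in> square_integrable \<and> v \<in> square_integrable \<and> locally_absolutely_continuous u \<and>
     (\<exists>u'. AE x in lebesgue. (u has_vector_derivative u' x) (at x) \<and>
        v x = (- \<i>) *s (\<sigma>\<^sub>2 *v u' x) + complex_of_real m *s (\<sigma>\<^sub>3 *v u x)
              + complex_of_real (q x) *s u x)}"


section \<open>Matrix-valued multiplication operators\<close>

definition Lp_matrix :: "real \<Rightarrow> (real \<Rightarrow> complex^2^2) set" where
  "Lp_matrix r = {A \<in> borel_measurable lebesgue.
     integrable lebesgue (\<lambda>x. onorm ((*v) (A x)) powr r)}"

definition mult_operator :: "(real \<Rightarrow> complex^2^2) \<Rightarrow> (L2 \<times> L2) set" where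
  "mult_operator A = {(abs_L2 u, abs_L2 (\<lambda>x. A x *v u x)) | u.
     u \<in> square_integrable \<and> (\<lambda>x. A x *v u x) \<in> square_integrable}"

end

theory Submission
  imports Defs "HOL-Complex_Analysis.Great_Picard"
begin

text \<open>Write $u = (H_0 - \lambda)^{-1} f$. Since $\sigma_2$ is invertible, $u'$ is a pointwise
  combination of \<open>f\<close>, \<open>u\<close> and \<open>q u\<close>. The potential term is real orthogonal to \<open>u\<close> and drops out of
  $(|u|^2)'$, which gives a bound of $\sup |u|$ by the $L^2$ norms of \<open>f\<close> and \<open>u\<close>; integrating $u'$
  over short intervals then shows that the functions \<open>u\<close> belonging to $\|f\| \le 1$ are
  equicontinuous at each point. So a sequence of them has a subsequence \<open>u\<^sub>n\<close> that is bounded and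
  converges pointwise on the real line, by Fatou's lemma to an $L^2$ function \<open>v\<close>. Finally
  $\|A\|^2 \le \varepsilon + \varepsilon^{1-p} \|A\|^{2p}$, so $\int |A (u_n - v)|^2$ is at most
  $\varepsilon \|u_n - v\|^2$ plus an integral that tends to 0 by dominated convergence.\<close>

subsection \<open>Absolutely continuous functions\<close>

text \<open>Members of a division have disjoint interiors, so two of them overlap in an interval
  without interior, a null set. Their lengths therefore add up to the measure of their union, which
  lies in \<open>U\<close>. This turns an open set of small measure into the length condition that
  absolute continuity asks for.\<close>

lemma sum_measure_division_le:
  assumes D: "D division_of T" and TU: "T \<subseteq> U" and U: "U \<in> lmeasurable"
  shows "(\<Sum>K\<in>D. measure lborel K) \<le> measure lebesgue (U :: real set)"
proof -
  have cb: "\<exists>a b. K = cbox a b" if "K \<in> D" for K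
    using D that by blast
  have "(\<Sum>K\<in>D. measure lborel K) = (\<Sum>K\<in>D. measure lebesgue K)"
    using cb by (intro sum.cong refl) fastforce
  also have "\<dots> = measure lebesgue (\<Union>D)"
  proof (rule measure_negligible_finite_Union[symmetric])
    show "finite D" using D by blast
    show "K \<in> lmeasurable" if "K \<in> D" for K using cb[OF that] by fastforce
    show "pairwise (\<lambda>K L. negligible (K \<inter> L)) D"
    proof (rule pairwiseI)
      fix K L assume KL: "K \<in> D" "L \<in> D" "K \<noteq> L"
      then have "interior K \<inter> interior L = {}" using D by blast
      then have "interior (K \<inter> L) = {}" by simp
      moreover obtain a b c d where "K = cbox a b" "L = cbox c d"
        using cb[OF KL(1)] cb[OF KL(2)] by blast
      then have "K \<inter> L = cbox (max a c) (min b d)"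
        by auto
      ultimately show "negligible (K \<inter> L)"
        by (metis interior_cbox negligible_interval(1))
    qed
  qed
  also have "\<dots> \<le> measure lebesgue U"
  proof (rule measure_mono_fmeasurable)
    show "\<Union>D \<subseteq> U" using D TU by blast
    show "\<Union>D \<in> sets lebesgue" using D cb by (intro sets.finite_Union) fastforce+
  qed (rule U)
  finally show ?thesis .
qed

text \<open>A single interval \<open>{s..t}\<close> is a division of itself, so the condition on
  divisions already controls one increment.\<close>

lemma absolutely_continuous_on_imp_continuous_on:
  assumes ac: "absolutely_continuous_on {a..b} f"
  shows "continuous_on {a..b} f"
  unfolding continuous_on_iff
proof (intro ballI allI impI)
  fix x and e :: real assume x: "x \<in> {a..b}" and "0 < e"
  then obtain d where "d > 0" and d: "\<And>D T. \<lbrakk>D division_of T; T \<subseteq> {a..b};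
      (\<Sum>K\<in>D. measure lborel K) < d\<rbrakk> \<Longrightarrow> (\<Sum>K\<in>D. norm (f (Sup K) - f (Inf K))) < e"
    using ac unfolding absolutely_continuous_on_def by meson
  have inc: "norm (f t - f s) < e" if "s \<in> {a..b}" "t \<in> {a..b}" "s \<le> t" "t - s < d" for s t
    using d[of "{{s..t}}" "{s..t}"] that division_of_self[of s t] by simp
  then have "dist (f y) (f x) < e" if "y \<in> {a..b}" "dist y x < d" for y
    using that x inc[of x y] inc[of y x]
    by (cases "x \<le> y") (auto simp: dist_norm norm_minus_commute)
  with \<open>d > 0\<close> show "\<exists>d>0. \<forall>y\<in>{a..b}. dist y x < d \<longrightarrow> dist (f y) (f x) < e" by blast
qed

text \<open>The tags in the exceptional null set get a gauge inside an open set of small measure, where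
  absolute continuity makes the increments of \<open>f\<close> negligible.\<close>

lemma fundamental_theorem_of_calculus_absolutely_continuous:
  fixes f :: "real \<Rightarrow> 'a::banach"
  assumes "a \<le> b" and ac: "absolutely_continuous_on {a..b} f" and N: "negligible N"
    and deriv: "\<And>x. x \<in> {a..b} - N \<Longrightarrow> (f has_vector_derivative f' x) (at x)"
  shows "(f' has_integral (f b - f a)) {a..b}"
proof -
  \<comment> \<open>With the integrand set to 0 on \<open>N\<close>, a tag in \<open>N\<close>
    contributes only the increment of \<open>f\<close> over its interval to the error. The change on
    a null set is undone at the end.\<close>
  define g where "g = (\<lambda>x. if x \<in> N then 0 else f' x)"
  define \<Delta> where "\<Delta> = (\<lambda>K. f (Sup K) - f (Inf K))"
  have "(g has_integral (f b - f a)) (cbox a b)"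
    unfolding has_integral
  proof (intro allI impI)
    fix e :: real assume "e > 0"
    \<comment> \<open>The \<open>+ 1\<close> keeps the denominator positive when
      \<open>a = b\<close> and makes the bound \<open>e1 * (b - a) < e / 2\<close> strict.\<close>
    define e1 where "e1 = e / (2 * (b - a + 1))"
    have "e1 > 0" using \<open>e > 0\<close> \<open>a \<le> b\<close> by (simp add: e1_def)
    have e1: "e1 * (b - a) < e / 2"
    proof -
      have "e1 * (b - a) < e1 * (b - a + 1)" using \<open>e1 > 0\<close> by simp
      also have "\<dots> = e / 2" using \<open>a \<le> b\<close> by (simp add: e1_def divide_simps)
      finally show ?thesis .
    qed
    \<comment> \<open>The implication sits inside the existential so that a positive radius exists
      at every point, as a gauge requires; outside \<open>{a..b} - N\<close> the radius is
      arbitrary.\<close>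
    have "\<forall>x. \<exists>r>0. x \<in> {a..b} - N \<longrightarrow>
        (\<forall>y. norm (y - x) < r \<longrightarrow> norm (f y - f x - (y - x) *\<^sub>R f' x) \<le> e1 * norm (y - x))"
    proof
      fix x
      show "\<exists>r>0. x \<in> {a..b} - N \<longrightarrow>
        (\<forall>y. norm (y - x) < r \<longrightarrow> norm (f y - f x - (y - x) *\<^sub>R f' x) \<le> e1 * norm (y - x))"
      proof (cases "x \<in> {a..b} - N")
        case True
        then show ?thesis
          using deriv[OF True] \<open>e1 > 0\<close>
          unfolding has_vector_derivative_def has_derivative_at_alt by blast
      qed (use zero_less_one in blast)
    qed
    then obtain r where r: "\<And>x. r x > 0" and straddle: "\<And>x y. \<lbrakk>x \<in> {a..b} - N; norm (y - x) < r x\<rbrakk>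
        \<Longrightarrow> norm (f y - f x - (y - x) *\<^sub>R f' x) \<le> e1 * norm (y - x)"
      by metis
    obtain d where "d > 0" and d: "\<And>D T. \<lbrakk>D division_of T; T \<subseteq> {a..b};
        (\<Sum>K\<in>D. measure lborel K) < d\<rbrakk> \<Longrightarrow> (\<Sum>K\<in>D. norm (\<Delta> K)) < e / 2"
      using ac \<open>e > 0\<close> unfolding absolutely_continuous_on_def \<Delta>_def by (meson half_gt_zero)
    have N_sets: "N \<in> null_sets lebesgue"
      using N negligible_iff_null_sets by blast
    \<comment> \<open>Outer regularity bounds the measure of \<open>U - N\<close>. Since
      \<open>N\<close> is a null set, this is a bound for \<open>U\<close> itself.\<close>
    obtain U where "open U" "N \<subseteq> U" and U: "U - N \<in> lmeasurable"
        "emeasure lebesgue (U - N) < ennreal d"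
      using sets_lebesgue_outer_open[of N d] N_sets \<open>d > 0\<close> by blast
    have eU: "emeasure lebesgue U < ennreal d"
      using U(2) N_sets \<open>open U\<close> by (simp add: emeasure_Diff_null_set)
    then have Ul: "U \<in> lmeasurable"
      using \<open>open U\<close> by (intro fmeasurableI) (auto simp: less_top[symmetric] top_unique intro: order.strict_trans)
    have mU: "measure lebesgue U < d"
      using eU Ul \<open>d > 0\<close> by (simp add: emeasure_eq_measure2 ennreal_less_iff)
    define \<gamma> where "\<gamma> = (\<lambda>x. if x \<in> N then U else ball x (r x))"
    have gauge: "gauge \<gamma>"
      using \<open>open U\<close> \<open>N \<subseteq> U\<close> r by (auto simp: gauge_def \<gamma>_def)
    have main: "norm ((\<Sum>(x,K)\<in>p. measure lborel K *\<^sub>R g x) - (f b - f a)) < e"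
      if p: "p tagged_division_of cbox a b" and fine: "\<gamma> fine p" for p
    proof -
      define pN where "pN = {(x, K) \<in> p. x \<in> N}"
      have "finite p" using p by blast
      have pN: "pN \<subseteq> p" by (auto simp: pN_def)
        have sumN: "(\<Sum>(x,K)\<in>pN. norm (\<Delta> K)) < e / 2"
      proof -
        have part: "pN tagged_partial_division_of cbox a b"
          using p pN tagged_partial_division_subset by (metis tagged_division_of_def)
        note div = partial_division_of_tagged_division[OF part]
        have sub: "\<Union>(snd ` pN) \<subseteq> U"
          using fine pN by (fastforce simp: pN_def fine_def \<gamma>_def)
        \<comment> \<open>Passing from tagged pairs to intervals needs a function that vanishes on
          all intervals with empty interior. The empty interval is one of them, and
          \<open>Sup\<close> and \<open>Inf\<close> say nothing useful there, so \<open>h\<close> is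
          set to 0.\<close>
        define h where "h = (\<lambda>K. if K = {} then 0 else norm (\<Delta> K))"
        have "(\<Sum>(x,K)\<in>pN. norm (\<Delta> K)) = (\<Sum>(x,K)\<in>pN. h K)"
          using tagged_partial_division_ofD(2)[OF part] by (intro sum.cong) (fastforce simp: h_def)+
        also have "\<dots> = (\<Sum>K\<in>snd ` pN. h K)"
        proof (rule sum.over_tagged_division_lemma[OF tagged_partial_division_of_Union_self[OF part]])
          fix u v :: real assume "box u v = {}"
          then show "h (cbox u v) = 0"
            by (cases "u = v") (auto simp: h_def \<Delta>_def)
        qed
        also have "\<dots> \<le> (\<Sum>K\<in>snd ` pN. norm (\<Delta> K))"
          by (intro sum_mono) (simp add: h_def)
        also have "\<dots> < e / 2"
        proof (rule d[OF div])
          show "\<Union>(snd ` pN) \<subseteq> {a..b}"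
            using tagged_partial_division_ofD(3)[OF part] by fastforce
          show "(\<Sum>K\<in>snd ` pN. measure lborel K) < d"
            using sum_measure_division_le[OF div sub Ul] mU by simp
        qed
        finally show ?thesis .
      qed
      have ba: "b - a = (\<Sum>(x,K)\<in>p. Sup K - Inf K)" "f b - f a = (\<Sum>(x,K)\<in>p. \<Delta> K)"
        using additive_tagged_division_1[where f= "\<lambda>x. x"] additive_tagged_division_1[where f= f]
          \<open>a \<le> b\<close> p by (auto simp: \<Delta>_def)
      have len: "Sup K - Inf K \<ge> 0" if xK: "(x, K) \<in> p" for x K
      proof -
        obtain u v where k: "K = cbox u v" "x \<in> K"
          using tagged_division_ofD(2,4)[OF p xK] by blast
        then have "u \<le> v" by auto
        then show ?thesis by (simp add: k)
      qed
      have bound: "norm (measure lborel K *\<^sub>R g x - \<Delta> K) \<le> e1 * (Sup K - Inf K)" if xK: "(x, K) \<in> p - pN" for x K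
      proof -
        have "x \<notin> N" using xK by (auto simp: pN_def)
        obtain u v where k: "K = cbox u v" "x \<in> K" "K \<subseteq> cbox a b"
          using tagged_division_ofD(2,3,4)[OF p] xK by (metis DiffD1)
        then have uv: "u \<le> x" "x \<le> v" "x \<in> {a..b}" by auto
        have "K \<subseteq> \<gamma> x"
          using fine xK unfolding fine_def by blast
        then have "K \<subseteq> ball x (r x)"
          using \<open>x \<notin> N\<close> by (simp add: \<gamma>_def)
        moreover have "u \<in> K" "v \<in> K" using uv by (auto simp: k)
        ultimately have "u \<in> ball x (r x)" "v \<in> ball x (r x)" by blast+
        then have ball: "norm (u - x) < r x" "norm (v - x) < r x"
          by (simp_all add: dist_norm norm_minus_commute)
        \<comment> \<open>Both endpoints are compared with the tag through the derivative at
          \<open>x\<close>. Because \<open>u \<le> x \<le> v\<close>, the two error bounds add up to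
          exactly \<open>e1\<close> times the length of \<open>K\<close>.\<close>
        have "measure lborel K *\<^sub>R g x - \<Delta> K
            = (f u - f x - (u - x) *\<^sub>R f' x) - (f v - f x - (v - x) *\<^sub>R f' x)"
          using uv \<open>x \<notin> N\<close> by (simp add: k \<Delta>_def g_def algebra_simps)
        also have "norm \<dots> \<le> e1 * norm (u - x) + e1 * norm (v - x)"
          using uv \<open>x \<notin> N\<close>
          by (intro order_trans[OF norm_triangle_ineq4] add_mono straddle ball) auto
        also have "\<dots> = e1 * (Sup K - Inf K)"
          using uv by (simp add: k algebra_simps)
        finally show ?thesis .
      qed
      have "(\<Sum>(x,K)\<in>p. measure lborel K *\<^sub>R g x) - (f b - f a) = (\<Sum>(x,K)\<in>p. measure lborel K *\<^sub>R g x - \<Delta> K)"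
        by (simp add: ba sum_subtractf case_prod_unfold)
      also have "\<dots> = (\<Sum>(x,K)\<in>p - pN. measure lborel K *\<^sub>R g x - \<Delta> K) + (\<Sum>(x,K)\<in>pN. measure lborel K *\<^sub>R g x - \<Delta> K)"
        using \<open>finite p\<close> pN by (rule sum.subset_diff[rotated])
      also have "norm \<dots> \<le> (\<Sum>(x,K)\<in>p - pN. e1 * (Sup K - Inf K)) + (\<Sum>(x,K)\<in>pN. norm (\<Delta> K))"
      proof (intro norm_triangle_mono sum_norm_le)
        fix X
        show "norm (case X of (x, K) \<Rightarrow> measure lborel K *\<^sub>R g x - \<Delta> K)
            \<le> (case X of (x, K) \<Rightarrow> e1 * (Sup K - Inf K))" if "X \<in> p - pN"
          using bound[of "fst X" "snd X"] that by (simp add: case_prod_unfold)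
        show "norm (case X of (x, K) \<Rightarrow> measure lborel K *\<^sub>R g x - \<Delta> K) \<le> (case X of (x, K) \<Rightarrow> norm (\<Delta> K))"
          if "X \<in> pN"
          using that by (auto simp: pN_def g_def)
      qed
      also have "(\<Sum>(x,K)\<in>p - pN. e1 * (Sup K - Inf K)) \<le> (\<Sum>(x,K)\<in>p. e1 * (Sup K - Inf K))"
        using \<open>finite p\<close> len \<open>e1 > 0\<close> by (intro sum_mono2) (auto simp: mult_nonneg_nonneg)
      also have "\<dots> = e1 * (b - a)"
        by (simp add: ba sum_distrib_left case_prod_unfold)
      finally show ?thesis using e1 sumN by simp
    qed
    show "\<exists>\<gamma>. gauge \<gamma> \<and> (\<forall>p. p tagged_division_of cbox a b \<and> \<gamma> fine p \<longrightarrow>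
        norm ((\<Sum>(x,K)\<in>p. measure lborel K *\<^sub>R g x) - (f b - f a)) < e)"
      using gauge main by (intro exI[of _ \<gamma>] conjI allI impI) simp_all
  qed
  then show ?thesis
    unfolding box_real by (rule has_integral_spike[OF N, rotated]) (simp add: g_def)
qed

text \<open>Derivative and bound are given only almost everywhere. Once both integrands are set to 0
  on a common null set, the bound holds at every point, and the fundamental theorem carries it over
  to the increment.\<close>

lemma absolutely_continuous_increment_le:
  fixes f :: "real \<Rightarrow> 'a::banach"
  assumes "a \<le> b" and ac: "absolutely_continuous_on {a..b} f"
    and deriv: "AE x in lebesgue. (f has_vector_derivative f' x) (at x) \<and> norm (f' x) \<le> h x"
    and h: "h integrable_on {a..b}"
  shows "norm (f b - f a) \<le> integral {a..b} h"
proof -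
  obtain N where N: "N \<in> null_sets lebesgue"
    and sub: "{x \<in> space lebesgue. \<not> ((f has_vector_derivative f' x) (at x) \<and> norm (f' x) \<le> h x)} \<subseteq> N"
    using deriv unfolding eventually_ae_filter by blast
  have neg: "negligible N" using N negligible_iff_null_sets by blast
  have good: "(f has_vector_derivative f' x) (at x)" "norm (f' x) \<le> h x" if "x \<notin> N" for x
    using sub that by auto
  have "(f' has_integral (f b - f a)) {a..b}"
    using good by (intro fundamental_theorem_of_calculus_absolutely_continuous[OF \<open>a \<le> b\<close> ac neg]) auto
  then have "((\<lambda>x. if x \<in> N then 0 else f' x) has_integral (f b - f a)) {a..b}"
    by (rule has_integral_spike[OF neg, rotated]) simp
  moreover have "((\<lambda>x. if x \<in> N then 0 else h x) has_integral (integral {a..b} h)) {a..b}"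
    using integrable_integral[OF h] by (rule has_integral_spike[OF neg, rotated]) simp
  ultimately show ?thesis
    using good(2) has_integral_norm_bound_integral_component[where k = "1 :: real"
        and f = "\<lambda>x. if x \<in> N then 0 else f' x" and g = "\<lambda>x. if x \<in> N then 0 else h x"] by simp
qed

text \<open>On a compact interval \<open>f\<close> is bounded by some \<open>M\<close>, and squaring
  is Lipschitz with constant \<open>2 * M\<close> on the values of the norm.\<close>

lemma absolutely_continuous_on_norm_power2:
  assumes ac: "absolutely_continuous_on {a..b} f"
  shows "absolutely_continuous_on {a..b} (\<lambda>x. (norm (f x))\<^sup>2)"
  unfolding absolutely_continuous_on_def
proof (intro allI impI)
  fix e :: real assume "e > 0"
  have "bounded (f ` {a..b})"
    by (intro compact_imp_bounded compact_continuous_image compact_Icc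
        absolutely_continuous_on_imp_continuous_on ac)
  then obtain M where "M > 0" and M: "\<And>x. x \<in> {a..b} \<Longrightarrow> norm (f x) \<le> M"
    by (auto simp: bounded_pos)
  have inc: "norm ((norm (f s))\<^sup>2 - (norm (f t))\<^sup>2) \<le> 2 * M * norm (f s - f t)"
    if "s \<in> {a..b}" "t \<in> {a..b}" for s t
  proof -
    have "norm ((norm (f s))\<^sup>2 - (norm (f t))\<^sup>2) = (norm (f s) + norm (f t)) * \<bar>norm (f s) - norm (f t)\<bar>"
      by (simp add: power2_eq_square square_diff_square_factored abs_mult)
    also have "\<dots> \<le> (2 * M) * norm (f s - f t)"
      using M[OF that(1)] M[OF that(2)] \<open>M > 0\<close> by (intro mult_mono norm_triangle_ineq3) auto
    finally show ?thesis .
  qed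
  have "e / (2 * M) > 0" using \<open>e > 0\<close> \<open>M > 0\<close> by simp
  then obtain d where "d > 0" and d: "\<And>D T. \<lbrakk>D division_of T; T \<subseteq> {a..b};
      (\<Sum>K\<in>D. measure lborel K) < d\<rbrakk> \<Longrightarrow> (\<Sum>K\<in>D. norm (f (Sup K) - f (Inf K))) < e / (2 * M)"
    using ac unfolding absolutely_continuous_on_def by meson
  have "(\<Sum>K\<in>D. norm ((norm (f (Sup K)))\<^sup>2 - (norm (f (Inf K)))\<^sup>2)) < e"
    if D: "D division_of T" "T \<subseteq> {a..b}" "(\<Sum>K\<in>D. measure lborel K) < d" for D T
  proof -
    have "(\<Sum>K\<in>D. norm ((norm (f (Sup K)))\<^sup>2 - (norm (f (Inf K)))\<^sup>2))
        \<le> (\<Sum>K\<in>D. 2 * M * norm (f (Sup K) - f (Inf K)))"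
    proof (intro sum_mono inc)
      fix K assume K: "K \<in> D"
      obtain s t where "K = cbox s t" using division_ofD(4)[OF D(1) K] by blast
      moreover have "K \<noteq> {}" "K \<subseteq> {a..b}"
        using division_ofD(2,3)[OF D(1) K] D(2) by auto
      ultimately show "Sup K \<in> {a..b}" "Inf K \<in> {a..b}" by auto
    qed
    also have "\<dots> = 2 * M * (\<Sum>K\<in>D. norm (f (Sup K) - f (Inf K)))"
      by (simp add: sum_distrib_left)
    also have "\<dots> < e"
      using d[OF D] \<open>M > 0\<close> by (simp add: field_simps)
    finally show ?thesis .
  qed
  with \<open>d > 0\<close> show "\<exists>d>0. \<forall>D T. D division_of T \<and> T \<subseteq> {a..b} \<and> (\<Sum>K\<in>D. measure lborel K) < d \<longrightarrow>
      (\<Sum>K\<in>D. norm ((norm (f (Sup K)))\<^sup>2 - (norm (f (Inf K)))\<^sup>2)) < e"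
    by blast
qed

text \<open>A bridge from the Lebesgue integral over the line, which gives the L^2 norm, to the
  gauge integral over an interval, for which the increment estimate is stated.\<close>

lemma integral_Icc_le_lebesgue_integral:
  fixes h :: "real \<Rightarrow> real"
  assumes h: "integrable lebesgue h" and nonneg: "\<And>x. h x \<ge> 0"
  shows "h integrable_on {a..b}" "integral {a..b} h \<le> (LINT x|lebesgue. h x)"
proof -
  have H: "h integrable_on UNIV" "integral UNIV h = (LINT x|lebesgue. h x)"
    using h by (simp_all add: integrable_on_lebesgue integral_lebesgue)
  show ab: "h integrable_on {a..b}"
    using H(1) integrable_on_subinterval by blast
  show "integral {a..b} h \<le> (LINT x|lebesgue. h x)"
    using integral_subset_le[OF _ ab H(1)] nonneg H(2) by simp
qed

subsection \<open>A priori estimates for the resolvent of the Dirac operator\<close>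

text \<open>The inverse of the matrix $-i\sigma_2$.\<close>

definition rot :: "complex^2 \<Rightarrow> complex^2" where
  "rot w = vector [w $ 2, - w $ 1]"

lemma rot_nth [simp]: "rot w $ 1 = w $ 2" "rot w $ 2 = - w $ 1"
  by (simp_all add: rot_def)

lemma norm_rot [simp]: "norm (rot w) = norm w"
  by (simp add: norm_vec_def L2_set_def sum_2 add.commute)

text \<open>The two terms cancel by symmetry of the real inner product on complex numbers; the
  Hermitian product of \<open>rot w\<close> and \<open>w\<close> is purely imaginary and in general
  not 0. This is what removes the potential from the derivative of |u|^2.\<close>

lemma inner_rot_self [simp]: "rot w \<bullet> w = 0"
  by (simp add: inner_vec_def sum_2 inner_commute)

lemma norm_sigma3 [simp]: "norm (\<sigma>\<^sub>3 *v w) = norm w"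
  by (simp add: norm_vec_def L2_set_def sum_2 \<sigma>\<^sub>3_def matrix_vector_mult_def)

lemma of_real_scalar_mult: "complex_of_real r *s w = r *\<^sub>R (w :: complex^'n)"
  by (simp add: vec_eq_iff scaleR_conv_of_real[where 'a = complex])

text \<open>Applying \<open>rot\<close> to the equation isolates the derivative. The potential is
  kept apart as a multiple of \<open>rot w\<close>, so that its orthogonality to \<open>w\<close>
  can be used.\<close>

lemma dirac_equation_solved:
  assumes "v = (- \<i>) *s (\<sigma>\<^sub>2 *v d) + complex_of_real m *s (\<sigma>\<^sub>3 *v w) + complex_of_real r *s w"
  shows "d = rot (v - m *\<^sub>R (\<sigma>\<^sub>3 *v w)) - r *\<^sub>R rot w"
  unfolding assms of_real_scalar_mult
  by (simp add: vec_eq_iff forall_2 \<sigma>\<^sub>2_def \<sigma>\<^sub>3_def matrix_vector_mult_def sum_2 algebra_simps)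


text \<open>At a point x, \<open>w\<close> stands for u(x), \<open>d\<close> for u'(x),
  \<open>r\<close> for q(x) and \<open>g\<close> for the value of (H_0 - z) u, while
  \<open>c\<close> bounds the action of z and of the mass term. In the first estimate the potential
  cancels by orthogonality, so it can be integrated over the line. The second keeps
  \<open>\<bar>r\<bar>\<close>, which is integrable only locally.\<close>

lemma dirac_derivative_estimates:
  fixes z :: complex
  assumes v: "v = (- \<i>) *s (\<sigma>\<^sub>2 *v d) + complex_of_real m *s (\<sigma>\<^sub>3 *v w) + complex_of_real r *s w"
    and g: "g = v - z *s w" and c: "c = norm z + \<bar>m\<bar>"
  shows "\<bar>2 * (w \<bullet> d)\<bar> \<le> (norm g)\<^sup>2 + (1 + 2 * c) * (norm w)\<^sup>2"
    and "norm d \<le> norm g + (c + \<bar>r\<bar>) * norm w"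
proof -
  define b where "b = v - m *\<^sub>R (\<sigma>\<^sub>3 *v w)"
  have d: "d = rot b - r *\<^sub>R rot w"
    unfolding b_def by (rule dirac_equation_solved[OF v])
  have beq: "b = g + z *s w - m *\<^sub>R (\<sigma>\<^sub>3 *v w)"
    by (simp add: b_def g)
  have "norm b \<le> norm g + norm (z *s w) + norm (m *\<^sub>R (\<sigma>\<^sub>3 *v w))"
    unfolding beq
    using norm_triangle_ineq4[of "g + z *s w" "m *\<^sub>R (\<sigma>\<^sub>3 *v w)"] norm_triangle_ineq[of g "z *s w"]
    by linarith
  then have b: "norm b \<le> norm g + c * norm w"
    by (simp add: c norm_vector_scalar_mult algebra_simps)
  have "norm d \<le> norm b + \<bar>r\<bar> * norm w"
    unfolding d using norm_triangle_ineq4[of "rot b" "r *\<^sub>R rot w"] by simp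
  then show "norm d \<le> norm g + (c + \<bar>r\<bar>) * norm w"
    using b by (simp add: algebra_simps)
  have "w \<bullet> d = rot b \<bullet> w"
    by (simp add: d inner_diff_right inner_commute[of w])
  then have "\<bar>2 * (w \<bullet> d)\<bar> \<le> 2 * (norm b * norm w)"
    using Cauchy_Schwarz_ineq2[of "rot b" w] by simp
  also have "\<dots> \<le> 2 * ((norm g + c * norm w) * norm w)"
    using b by (intro mult_left_mono mult_right_mono) auto
  also have "\<dots> \<le> (norm g)\<^sup>2 + (1 + 2 * c) * (norm w)\<^sup>2"
    using sum_squares_bound[of "norm g" "norm w"] by (simp add: algebra_simps power2_eq_square)
  finally show "\<bar>2 * (w \<bullet> d)\<bar> \<le> (norm g)\<^sup>2 + (1 + 2 * c) * (norm w)\<^sup>2" .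
qed

lemma abs_L2_minus_scaleC:
  assumes u: "u \<in> square_integrable" and v: "v \<in> square_integrable"
  shows "(\<lambda>x. v x - z *s u x) \<in> square_integrable"
    and "abs_L2 v - scaleC z (abs_L2 u) = abs_L2 (\<lambda>x. v x - z *s u x)"
proof -
  note zu = square_integrable_scaleC[OF u, of z]
  note mzu = square_integrable_scaleR[OF zu, of "-1"]
  have eq: "(\<lambda>x. v x + (-1) *\<^sub>R (z *s u x)) = (\<lambda>x. v x - z *s u x)"
    by auto
  show "(\<lambda>x. v x - z *s u x) \<in> square_integrable"
    using square_integrable_add[OF v mzu] unfolding eq .
  have "scaleC z (abs_L2 u) = abs_L2 (\<lambda>x. z *s u x)"
    using u by (intro scaleC.abs_eq) simp
  moreover have "(-1) *\<^sub>R abs_L2 (\<lambda>x. z *s u x) = abs_L2 (\<lambda>x. (-1) *\<^sub>R (z *s u x))"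
    using zu by (intro scaleR_L2.abs_eq) simp
  moreover have "abs_L2 v + abs_L2 (\<lambda>x. (-1) *\<^sub>R (z *s u x))
      = abs_L2 (\<lambda>x. v x + (-1) *\<^sub>R (z *s u x))"
    using v mzu by (intro plus_L2.abs_eq) simp_all
  ultimately show "abs_L2 v - scaleC z (abs_L2 u) = abs_L2 (\<lambda>x. v x - z *s u x)"
    by (simp only: minus_L2_def uminus_L2_def eq)
qed

lemma norm_abs_L2_power2:
  assumes "u \<in> square_integrable"
  shows "(norm (abs_L2 u))\<^sup>2 = (LINT x|lebesgue. (norm (u x))\<^sup>2)"
  using norm_abs_L2[OF assms] by simp

text \<open>Here \<open>g\<close> is the solution for the datum \<open>f\<close>, and
  \<open>u\<close> is its locally absolutely continuous representative. The sup bound follows by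
  integrating the derivative of |u|^2, the increment bound by integrating that of \<open>u\<close>.
  Any admissible \<open>M\<close> is allowed, so that one value can serve a whole sequence, and the
  free parameter \<eta> lets the term with \<open>f\<close> be made small before the interval is
  shortened.\<close>

lemma resolvent_dirac_estimates:
  assumes q: "locally_integrable q" and fg: "(f, g) \<in> resolvent (dirac m q) z"
    and c: "c = norm z + \<bar>m\<bar>"
    and M: "(norm f)\<^sup>2 + (2 + 2 * c) * (norm g)\<^sup>2 \<le> M\<^sup>2" "M \<ge> 0"
  obtains u where "u \<in> square_integrable" "g = abs_L2 u" "\<And>x. norm (u x) \<le> M"
    "\<And>x y \<eta>. \<lbrakk>x \<le> y; \<eta> > 0\<rbrakk> \<Longrightarrow> norm (u y - u x) \<le>
        \<eta> * (norm f)\<^sup>2 + (1 / \<eta> + c * M) * (y - x) + M * integral {x..y} (\<lambda>t. \<bar>q t\<bar>)"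
proof -
  obtain g' where g': "(g, g') \<in> dirac m q" "f = g' - scaleC z g"
    using fg unfolding resolvent_def minus_scalar_def by auto
  then obtain u v u' where u: "u \<in> square_integrable" and v: "v \<in> square_integrable"
    and g: "g = abs_L2 u" and g'v: "g' = abs_L2 v"
    and ac: "locally_absolutely_continuous u"
    and ode: "AE x in lebesgue. (u has_vector_derivative u' x) (at x) \<and>
        v x = (- \<i>) *s (\<sigma>\<^sub>2 *v u' x) + complex_of_real m *s (\<sigma>\<^sub>3 *v u x) + complex_of_real (q x) *s u x"
    unfolding dirac_def by blast
  define w where "w = (\<lambda>x. v x - z *s u x)"
  have w: "w \<in> square_integrable" and f: "f = abs_L2 w"
    unfolding w_def using abs_L2_minus_scaleC[OF u v, of z] g'(2) g g'v by simp_all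
  have nf: "(norm f)\<^sup>2 = (LINT x|lebesgue. (norm (w x))\<^sup>2)"
    and ng: "(norm g)\<^sup>2 = (LINT x|lebesgue. (norm (u x))\<^sup>2)"
    using norm_abs_L2_power2 u w f g by simp_all
  note iw = square_integrableD(2)[OF w] and iu = square_integrableD(2)[OF u]
  have c0: "c \<ge> 0" by (simp add: c)
  have acu: "absolutely_continuous_on {s..t} u" for s t
    using ac by (simp add: locally_absolutely_continuous_def)
  have sup: "norm (u x) \<le> M" for x
  proof -
    define h where "h = (\<lambda>x. (norm (w x))\<^sup>2 + (1 + 2 * c) * (norm (u x))\<^sup>2)"
    have h: "integrable lebesgue h" "\<And>x. h x \<ge> 0"
      using iw iu c0 by (simp_all add: h_def)
    have hI: "(LINT x|lebesgue. h x) = (norm f)\<^sup>2 + (1 + 2 * c) * (norm g)\<^sup>2"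
      unfolding h_def nf ng using iw iu by simp
    have deriv: "AE x in lebesgue. ((\<lambda>x. (norm (u x))\<^sup>2) has_vector_derivative 2 * (u x \<bullet> u' x)) (at x)
        \<and> norm (2 * (u x \<bullet> u' x)) \<le> h x"
      using ode
    proof eventually_elim
      case (elim x)
      then have D: "(u has_derivative (\<lambda>t. t *\<^sub>R u' x)) (at x)"
        by (simp add: has_vector_derivative_def)
      have "((\<lambda>x. u x \<bullet> u x) has_vector_derivative 2 * (u x \<bullet> u' x)) (at x)"
        using has_derivative_inner[OF D D]
        by (simp add: has_vector_derivative_def inner_commute algebra_simps)
      then show ?case
        using dirac_derivative_estimates(1)[where v = "v x" and d = "u' x" and w = "u x" and r = "q x",
            OF _ refl c] elim
        by (simp add: power2_norm_eq_inner h_def w_def)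
    qed
    have le: "(norm (u x))\<^sup>2 \<le> (norm (u y))\<^sup>2 + (LINT x|lebesgue. h x)" if "y \<in> {x..x+1}" for y
    proof -
      have "norm ((norm (u y))\<^sup>2 - (norm (u x))\<^sup>2) \<le> integral {x..y} h"
        using that by (intro absolutely_continuous_increment_le[OF _ _ deriv]
            absolutely_continuous_on_norm_power2 acu integral_Icc_le_lebesgue_integral[OF h]) auto
      also have "\<dots> \<le> (LINT x|lebesgue. h x)"
        by (rule integral_Icc_le_lebesgue_integral[OF h])
      finally show ?thesis by (simp add: abs_le_iff)
    qed
    \<comment> \<open>Averaging over y in an interval of length 1 replaces the unknown value
      |u(y)|^2 by its integral, which is at most \<open>(norm g)\<^sup>2\<close>. Together with the
      integral of \<open>h\<close> this gives the factor 2 + 2c = 1 + (1 + 2c).\<close>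
    have "(norm (u x))\<^sup>2 = integral {x..x+1} (\<lambda>y. (norm (u x))\<^sup>2)"
      by simp
    also have "\<dots> \<le> integral {x..x+1} (\<lambda>y. (norm (u y))\<^sup>2 + (LINT x|lebesgue. h x))"
      using le integral_Icc_le_lebesgue_integral(1)[OF iu]
      by (intro integral_le integrable_add integrable_const_ivl) auto
    also have "\<dots> = integral {x..x+1} (\<lambda>y. (norm (u y))\<^sup>2) + (LINT x|lebesgue. h x)"
      using integral_Icc_le_lebesgue_integral(1)[OF iu] by (subst integral_add) auto
    also have "\<dots> \<le> (norm g)\<^sup>2 + (LINT x|lebesgue. h x)"
      unfolding ng using integral_Icc_le_lebesgue_integral(2)[OF iu] by simp
    also have "\<dots> \<le> M\<^sup>2"
      using M hI by (simp add: algebra_simps)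
    finally show ?thesis
      using M(2) by (rule power2_le_imp_le)
  qed
  have inc: "norm (u y - u x) \<le>
        \<eta> * (norm f)\<^sup>2 + (1 / \<eta> + c * M) * (y - x) + M * integral {x..y} (\<lambda>t. \<bar>q t\<bar>)"
    if "x \<le> y" "\<eta> > 0" for x y \<eta>
  proof -
    have qi: "(\<lambda>t. \<bar>q t\<bar>) integrable_on {x..y}"
      using q unfolding locally_integrable_def absolutely_integrable_on_def by auto
    have wi: "(\<lambda>t. (norm (w t))\<^sup>2) integrable_on {x..y}"
      "integral {x..y} (\<lambda>t. (norm (w t))\<^sup>2) \<le> (norm f)\<^sup>2"
      unfolding nf by (rule integral_Icc_le_lebesgue_integral[OF iw], simp)+
    define h where "h = (\<lambda>t. \<eta> * (norm (w t))\<^sup>2 + (1 / \<eta> + c * M) + M * \<bar>q t\<bar>)"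
    have deriv: "AE t in lebesgue. (u has_vector_derivative u' t) (at t) \<and> norm (u' t) \<le> h t"
      using ode
    proof eventually_elim
      case (elim t)
      \<comment> \<open>The square of \<open>\<eta> * norm (w t) - 1\<close> is nonnegative. This
        bounds \<open>norm (w t)\<close> by its square, whose integral \<open>norm f\<close>
        controls, and takes the place of the Cauchy-Schwarz inequality for integrals.\<close>
      have "norm (w t) \<le> \<eta> * (norm (w t))\<^sup>2 + 1 / \<eta>"
      proof -
        have "0 \<le> (\<eta> * norm (w t) - 1)\<^sup>2" by simp
        then have "2 * \<eta> * norm (w t) \<le> (\<eta> * (norm (w t)))\<^sup>2 + 1"
          by (simp add: power2_diff)
        then have "2 * norm (w t) \<le> \<eta> * (norm (w t))\<^sup>2 + 1 / \<eta>"
          using that(2) by (simp add: field_simps power2_eq_square)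
        then show ?thesis using norm_ge_zero[of "w t"] by linarith
      qed
      moreover have "norm (u' t) \<le> norm (w t) + (c + \<bar>q t\<bar>) * norm (u t)"
        using dirac_derivative_estimates(2)[OF _ refl c] elim by (simp add: w_def)
      moreover have "(c + \<bar>q t\<bar>) * norm (u t) \<le> (c + \<bar>q t\<bar>) * M"
        using sup c0 by (intro mult_left_mono) auto
      ultimately show ?case
        using elim by (simp add: h_def algebra_simps)
    qed
    have hi: "(h has_integral (\<eta> * integral {x..y} (\<lambda>t. (norm (w t))\<^sup>2)
        + (y - x) * (1 / \<eta> + c * M) + M * integral {x..y} (\<lambda>t. \<bar>q t\<bar>))) {x..y}"
      unfolding h_def
      using has_integral_const_real[of "1 / \<eta> + c * M" x y] \<open>x \<le> y\<close>
      by (intro has_integral_add has_integral_mult_right integrable_integral wi qi) simp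
    have "norm (u y - u x) \<le> integral {x..y} h"
      by (rule absolutely_continuous_increment_le[OF \<open>x \<le> y\<close> acu deriv]) (use hi in blast)
    also have "\<dots> \<le> \<eta> * (norm f)\<^sup>2 + (1 / \<eta> + c * M) * (y - x) + M * integral {x..y} (\<lambda>t. \<bar>q t\<bar>)"
      using hi wi(2) that(2) by (simp add: integral_unique mult.commute)
    finally show ?thesis .
  qed
  show thesis by (rule that[OF u g sup inc])
qed

subsection \<open>Compactness of sequences\<close>

text \<open>A sequence in the closure is shadowed by one in \<open>S\<close> at distances tending to
  0, and both have the same subsequential limits. So only sequences in the image of the unit ball
  itself have to be studied.\<close>

lemma compact_closureI_sequentially:
  fixes S :: "'a::metric_space set"
  assumes sub: "\<And>f :: nat \<Rightarrow> 'a. (\<And>n. f n \<in> S) \<Longrightarrow> \<exists>l r. strict_mono r \<and> (f \<circ> r) \<longlonglongrightarrow> l"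
  shows "compact (closure S)"
  unfolding compact_eq_seq_compact_metric seq_compact_def
proof (intro allI impI)
  fix f :: "nat \<Rightarrow> 'a" assume f: "\<forall>n. f n \<in> closure S"
  have "\<exists>y\<in>S. dist y (f n) < inverse (real (Suc n))" for n
    using f closure_approachable[of "f n" S] by simp
  then obtain g where gS: "\<And>n. g n \<in> S" and g: "\<And>n. dist (g n) (f n) < inverse (real (Suc n))"
    by metis
  obtain l r where r: "strict_mono r" and l: "(g \<circ> r) \<longlonglongrightarrow> l"
    using sub[of g] gS by blast
  have "(\<lambda>n. dist (g n) (f n)) \<longlonglongrightarrow> 0"
    by (rule tendsto_sandwich[OF _ _ tendsto_const LIMSEQ_inverse_real_of_nat])
      (use g in \<open>auto intro!: always_eventually less_imp_le\<close>)
  then have "(\<lambda>n. dist (g (r n)) (f (r n))) \<longlonglongrightarrow> 0"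
    using LIMSEQ_subseq_LIMSEQ[OF _ r] by (fastforce simp: o_def)
  moreover have "(\<lambda>n. dist (g (r n)) l) \<longlonglongrightarrow> 0"
    using l by (simp add: o_def tendsto_dist_iff[symmetric])
  ultimately have lim: "(\<lambda>n. dist (g (r n)) (f (r n)) + dist (g (r n)) l) \<longlonglongrightarrow> 0"
    using tendsto_add by fastforce
  have "(\<lambda>n. dist (f (r n)) l) \<longlonglongrightarrow> 0"
  proof (rule tendsto_sandwich[OF _ _ tendsto_const lim])
    show "\<forall>\<^sub>F n in sequentially. dist (f (r n)) l \<le> dist (g (r n)) (f (r n)) + dist (g (r n)) l"
      by (intro always_eventually allI) (metis dist_commute dist_triangle)
  qed simp
  then have "(f \<circ> r) \<longlonglongrightarrow> l"
    by (simp add: o_def tendsto_dist_iff[symmetric])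
  moreover have "l \<in> closure S"
    using l gS unfolding closure_sequential by (auto intro!: exI[of _ "g \<circ> r"])
  ultimately show "\<exists>l\<in>closure S. \<exists>r. strict_mono r \<and> (f \<circ> r) \<longlonglongrightarrow> l"
    using r by blast
qed

text \<open>The argument of Arzela and Ascoli: boundedness gives a subsequence that converges at all
  rationals, and equicontinuity at \<open>x\<close> moves the Cauchy property from a nearby rational
  to \<open>x\<close>. Pointwise convergence is all that dominated convergence will ask for.\<close>

lemma equicontinuous_pointwise_convergent_subsequence:
  fixes f :: "nat \<Rightarrow> real \<Rightarrow> 'b::{banach, heine_borel}"
  assumes bound: "\<And>n x. norm (f n x) \<le> M"
    and equi: "\<And>x e. e > 0 \<Longrightarrow> \<exists>d>0. \<forall>n y. \<bar>y - x\<bar> < d \<longrightarrow> norm (f n y - f n x) < e"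
  obtains r g where "strict_mono r" "\<And>x. (\<lambda>n. f (r n) x) \<longlonglongrightarrow> g x"
proof -
  obtain r :: "nat \<Rightarrow> nat" where r: "strict_mono r"
    and rat: "\<And>x. x \<in> \<rat> \<Longrightarrow> \<exists>l. (\<lambda>n. f (r n) x) \<longlonglongrightarrow> l"
    using function_convergent_subsequence[of "\<rat> :: real set" f M] countable_rat bound by blast
  have "convergent (\<lambda>n. f (r n) x)" for x
    unfolding Cauchy_convergent_iff[symmetric]
  proof (rule metric_CauchyI)
    fix e :: real assume "e > 0"
    then obtain d where "d > 0" and d: "\<And>n y. \<bar>y - x\<bar> < d \<Longrightarrow> norm (f n y - f n x) < e / 3"
      using equi[of "e / 3" x] by auto
    obtain y where y: "y \<in> \<rat>" "x < y" "y < x + d"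
      using Rats_dense_in_real[of x "x + d"] \<open>d > 0\<close> by auto
    then have "Cauchy (\<lambda>n. f (r n) y)"
      using rat LIMSEQ_imp_Cauchy by blast
    then obtain K where K: "\<And>i j. i \<ge> K \<Longrightarrow> j \<ge> K \<Longrightarrow> dist (f (r i) y) (f (r j) y) < e / 3"
      using \<open>e > 0\<close> metric_CauchyD[of _ "e / 3"] by (metis divide_pos_pos zero_less_numeral)
    have "dist (f (r i) x) (f (r j) x) < e" if "i \<ge> K" "j \<ge> K" for i j
    proof -
      have n: "dist (f (r n) x) (f (r n) y) < e / 3" for n
        using d[of y "r n"] y by (simp add: dist_norm norm_minus_commute)
      have "dist (f (r i) x) (f (r j) x)
          \<le> dist (f (r i) x) (f (r i) y) + dist (f (r i) y) (f (r j) y) + dist (f (r j) x) (f (r j) y)"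
        using dist_triangle[of "f (r i) x" "f (r j) x" "f (r i) y"]
          dist_triangle[of "f (r i) y" "f (r j) x" "f (r j) y"]
        by (simp add: dist_commute)
      then show ?thesis using n[of i] n[of j] K[OF that] by linarith
    qed
    then show "\<exists>K. \<forall>i\<ge>K. \<forall>j\<ge>K. dist (f (r i) x) (f (r j) x) < e" by blast
  qed
  then show thesis
    using that[OF r, of "\<lambda>x. lim (\<lambda>n. f (r n) x)"] by (simp add: convergent_LIMSEQ_iff)
qed

subsection \<open>Multiplication by a matrix function\<close>

text \<open>If t^2 > e, then the factor (t^2)^(1-p) is at most e^(1-p), because the exponent is not
  positive. Applied to the norm of A, this splits its square into a small constant and an integrable
  function.\<close>

lemma square_le_powr_interpolation:
  fixes t p e :: real
  assumes "t \<ge> 0" "p \<ge> 1" "e > 0"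
  shows "t\<^sup>2 \<le> e + e powr (1 - p) * t powr (2 * p)"
proof (cases "t\<^sup>2 \<le> e")
  case True
  then show ?thesis by (simp add: add_increasing2)
next
  case False
  then have "t > 0" using assms by (cases "t = 0") auto
  have "t\<^sup>2 = t powr 2"
    using \<open>t > 0\<close> by (simp add: powr_numeral)
  also have "\<dots> = (t powr 2) powr (1 - p) * t powr (2 * p)"
    by (simp add: powr_powr powr_add[symmetric] algebra_simps)
  also have "\<dots> \<le> e powr (1 - p) * t powr (2 * p)"
    using False assms \<open>t > 0\<close>
    by (intro mult_right_mono powr_mono2') (auto simp: powr_numeral)
  finally show ?thesis using \<open>e > 0\<close> by linarith
qed

lemma borel_measurable_matrix_vector_mult:
  fixes A :: "'a \<Rightarrow> complex^'n^'m"
  assumes "A \<in> borel_measurable M" "u \<in> borel_measurable M"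
  shows "(\<lambda>x. A x *v u x) \<in> borel_measurable M"
proof (rule borel_measurable_continuous_Pair[OF assms])
  show "continuous_on UNIV (\<lambda>P. (fst P :: complex^'n^'m) *v snd P)"
    unfolding matrix_vector_mult_def by (intro continuous_intros)
qed

text \<open>The weight is integrable and \<open>u\<close> is bounded, so the weighted integral is
  finite; the rest is the interpolation inequality at each point. The case \<open>e = 1\<close>
  already gives square integrability, while small \<open>e\<close> is for the convergence
  proof.\<close>

lemma square_integrable_mult:
  assumes A: "A \<in> Lp_matrix (2 * p)" and p: "p \<ge> 1" and u: "u \<in> square_integrable"
    and M: "\<And>x. norm (u x) \<le> M"
  shows "integrable lebesgue (\<lambda>x. onorm ((*v) (A x)) powr (2 * p) * (norm (u x))\<^sup>2)"
    and "(\<lambda>x. A x *v u x) \<in> square_integrable"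
    and "e > 0 \<Longrightarrow> (LINT x|lebesgue. (norm (A x *v u x))\<^sup>2) \<le> e * (LINT x|lebesgue. (norm (u x))\<^sup>2)
        + e powr (1 - p) * (LINT x|lebesgue. onorm ((*v) (A x)) powr (2 * p) * (norm (u x))\<^sup>2)"
proof -
  define a where "a = (\<lambda>x. onorm ((*v) (A x)) powr (2 * p))"
  have Am: "A \<in> borel_measurable lebesgue" and ai: "integrable lebesgue a"
    using A by (auto simp: Lp_matrix_def a_def)
  note [measurable] = borel_measurable_integrable[OF ai] square_integrableD(1)[OF u]
    borel_measurable_matrix_vector_mult[OF Am square_integrableD(1)[OF u]]
  have au: "integrable lebesgue (\<lambda>x. a x * (norm (u x))\<^sup>2)"
  proof (rule Bochner_Integration.integrable_bound)
    show "integrable lebesgue (\<lambda>x. a x * M\<^sup>2)" using ai by simp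
    show "AE x in lebesgue. norm (a x * (norm (u x))\<^sup>2) \<le> norm (a x * M\<^sup>2)"
      using M by (intro AE_I2) (auto simp: a_def abs_mult intro!: mult_left_mono power_mono)
  qed measurable
  then show "integrable lebesgue (\<lambda>x. onorm ((*v) (A x)) powr (2 * p) * (norm (u x))\<^sup>2)"
    by (simp add: a_def)
  have le: "(norm (A x *v u x))\<^sup>2 \<le> e * (norm (u x))\<^sup>2 + e powr (1 - p) * (a x * (norm (u x))\<^sup>2)"
    if "e > 0" for e x
  proof -
    have bl: "bounded_linear ((*v) (A x))" by simp
    have "(norm (A x *v u x))\<^sup>2 \<le> (onorm ((*v) (A x)) * norm (u x))\<^sup>2"
      by (intro power_mono onorm[OF bl] norm_ge_zero)
    also have "\<dots> = (onorm ((*v) (A x)))\<^sup>2 * (norm (u x))\<^sup>2"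
      by (simp add: power_mult_distrib)
    also have "\<dots> \<le> (e + e powr (1 - p) * a x) * (norm (u x))\<^sup>2"
      unfolding a_def using onorm_pos_le[OF bl] p that
      by (intro mult_right_mono square_le_powr_interpolation) auto
    finally show ?thesis by (simp add: algebra_simps)
  qed
  have rhs: "integrable lebesgue (\<lambda>x. e * (norm (u x))\<^sup>2 + e powr (1 - p) * (a x * (norm (u x))\<^sup>2))" for e
    using au square_integrableD(2)[OF u] by simp
  have Au: "integrable lebesgue (\<lambda>x. (norm (A x *v u x))\<^sup>2)"
  proof (rule Bochner_Integration.integrable_bound[OF rhs[of 1]])
    show "AE x in lebesgue. norm ((norm (A x *v u x))\<^sup>2)
        \<le> norm (1 * (norm (u x))\<^sup>2 + 1 powr (1 - p) * (a x * (norm (u x))\<^sup>2))"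
      using le[of 1] by (intro AE_I2) (auto intro: order_trans[OF _ abs_ge_self])
  qed measurable
  then show "(\<lambda>x. A x *v u x) \<in> square_integrable"
    by (simp add: square_integrable_def)
  show "(LINT x|lebesgue. (norm (A x *v u x))\<^sup>2) \<le> e * (LINT x|lebesgue. (norm (u x))\<^sup>2)
        + e powr (1 - p) * (LINT x|lebesgue. onorm ((*v) (A x)) powr (2 * p) * (norm (u x))\<^sup>2)" if "e > 0"
  proof -
    have "(LINT x|lebesgue. (norm (A x *v u x))\<^sup>2)
        \<le> (LINT x|lebesgue. e * (norm (u x))\<^sup>2 + e powr (1 - p) * (a x * (norm (u x))\<^sup>2))"
      by (intro integral_mono Au rhs le that)
    also have "\<dots> = e * (LINT x|lebesgue. (norm (u x))\<^sup>2)
        + e powr (1 - p) * (LINT x|lebesgue. a x * (norm (u x))\<^sup>2)"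
      using au square_integrableD(2)[OF u] by simp
    finally show ?thesis by (simp add: a_def)
  qed
qed

section \<open>Pointwise limits and convergence in L^2\<close>

lemma square_integrable_Fatou:
  assumes u: "\<And>n. u n \<in> square_integrable" and B: "\<And>n. (LINT x|lebesgue. (norm (u n x))\<^sup>2) \<le> B"
    and lim: "\<And>x. (\<lambda>n. u n x) \<longlonglongrightarrow> v x"
  shows "v \<in> square_integrable"
proof -
  note [measurable] = square_integrableD(1)[OF u]
  have vm [measurable]: "v \<in> borel_measurable lebesgue"
    by (rule borel_measurable_LIMSEQ_metric[OF square_integrableD(1)[OF u] lim])
  have "(\<integral>\<^sup>+x. ennreal ((norm (v x))\<^sup>2) \<partial>lebesgue)
      = (\<integral>\<^sup>+x. liminf (\<lambda>n. ennreal ((norm (u n x))\<^sup>2)) \<partial>lebesgue)"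
  proof (rule nn_integral_cong)
    fix x
    have "(\<lambda>n. ennreal ((norm (u n x))\<^sup>2)) \<longlonglongrightarrow> ennreal ((norm (v x))\<^sup>2)"
      by (intro tendsto_intros lim)
    then show "ennreal ((norm (v x))\<^sup>2) = liminf (\<lambda>n. ennreal ((norm (u n x))\<^sup>2))"
      by (rule lim_imp_Liminf[OF sequentially_bot, symmetric])
  qed
  also have "\<dots> \<le> liminf (\<lambda>n. \<integral>\<^sup>+x. ennreal ((norm (u n x))\<^sup>2) \<partial>lebesgue)"
    by (rule nn_integral_liminf) measurable
  also have "\<dots> \<le> ennreal B"
    using B square_integrableD(2)[OF u]
    by (intro Liminf_le always_eventually allI) (auto simp: nn_integral_eq_integral ennreal_leI)
  finally have "(\<integral>\<^sup>+x. ennreal ((norm (v x))\<^sup>2) \<partial>lebesgue) < \<infinity>"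
    using le_less_trans by fastforce
  then show ?thesis
    by (auto simp: square_integrable_def intro!: integrableI_nonneg)
qed

lemma square_integrable_diff:
  assumes u: "u \<in> square_integrable" and v: "v \<in> square_integrable"
  shows "(\<lambda>x. u x - v x) \<in> square_integrable"
  using square_integrable_add[OF u square_integrable_scaleR[OF v, of "-1"]] by simp

text \<open>The functions \<open>u n\<close> need not converge to \<open>v\<close> in L^2, since
  mass may escape to infinity. The product with \<open>A\<close> does converge: one part of its
  squared error is a small multiple of a bounded quantity, and the other carries an integrable
  weight and tends to 0 by dominated convergence.\<close>

lemma mult_tendsto_L2:
  assumes A: "A \<in> Lp_matrix (2 * p)" and p: "p \<ge> 1" and u: "\<And>n. u n \<in> square_integrable"
    and B: "\<And>n. (LINT x|lebesgue. (norm (u n x))\<^sup>2) \<le> B"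
    and M: "\<And>n x. norm (u n x) \<le> M"
    and lim: "\<And>x. (\<lambda>n. u n x) \<longlonglongrightarrow> v x"
  shows "v \<in> square_integrable" "(\<lambda>x. A x *v v x) \<in> square_integrable"
    "(\<lambda>n. LINT x|lebesgue. (norm (A x *v u n x - A x *v v x))\<^sup>2) \<longlonglongrightarrow> 0"
proof -
  show v: "v \<in> square_integrable" by (rule square_integrable_Fatou[OF u B lim])
  have vM: "norm (v x) \<le> M" for x
    using Lim_norm_ubound[OF _ lim] M by simp
  show "(\<lambda>x. A x *v v x) \<in> square_integrable"
    by (rule square_integrable_mult(2)[OF A p v vM])
  define d where "d = (\<lambda>n x. u n x - v x)"
  have d: "d n \<in> square_integrable" for n
    unfolding d_def by (rule square_integrable_diff[OF u v])
  have dM: "norm (d n x) \<le> 2 * M" for n x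
    using norm_triangle_ineq4[of "u n x" "v x"] M[of n x] vM[of x] by (simp add: d_def)
  \<comment> \<open>The first two terms come from (s + t)^2 \<le> 2 s^2 + 2 t^2; the
    \<open>+ 1\<close> makes \<open>D\<close> strictly positive, so that it may be divided
    by.\<close>
  define D where "D = 2 * B + 2 * (LINT x|lebesgue. (norm (v x))\<^sup>2) + 1"
  have D: "(LINT x|lebesgue. (norm (d n x))\<^sup>2) < D" for n
  proof -
    have "(LINT x|lebesgue. (norm (d n x))\<^sup>2)
        \<le> (LINT x|lebesgue. 2 * (norm (u n x))\<^sup>2 + 2 * (norm (v x))\<^sup>2)"
    proof (rule integral_mono)
      fix x
      have "(norm (d n x))\<^sup>2 \<le> (norm (u n x) + norm (v x))\<^sup>2"
        unfolding d_def by (intro power_mono norm_triangle_ineq4 norm_ge_zero)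
      also have "\<dots> \<le> 2 * (norm (u n x))\<^sup>2 + 2 * (norm (v x))\<^sup>2"
        using sum_squares_bound[of "norm (u n x)" "norm (v x)"] by (simp add: power2_sum)
      finally show "(norm (d n x))\<^sup>2 \<le> 2 * (norm (u n x))\<^sup>2 + 2 * (norm (v x))\<^sup>2" .
    qed (use square_integrableD(2)[OF d] square_integrableD(2)[OF u] square_integrableD(2)[OF v] in simp_all)
    also have "\<dots> < D"
      using B[of n] square_integrableD(2)[OF u] square_integrableD(2)[OF v] by (simp add: D_def)
    finally show ?thesis .
  qed
  have "0 \<le> (LINT x|lebesgue. (norm (d 0 x))\<^sup>2)" by simp
  then have "D > 0" using D[of 0] by linarith
  define a where "a = (\<lambda>x. onorm ((*v) (A x)) powr (2 * p))"
  have ai: "integrable lebesgue a"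
    using A by (auto simp: Lp_matrix_def a_def)
  define I where "I = (\<lambda>n. LINT x|lebesgue. a x * (norm (d n x))\<^sup>2)"
  have "I \<longlonglongrightarrow> integral\<^sup>L lebesgue (\<lambda>x::real. 0)"
    unfolding I_def
  proof (rule integral_dominated_convergence)
    note [measurable] = square_integrableD(1)[OF d] borel_measurable_integrable[OF ai]
    show "integrable lebesgue (\<lambda>x. a x * (2 * M)\<^sup>2)" using ai by simp
    show "(\<lambda>x. a x * (norm (d n x))\<^sup>2) \<in> borel_measurable lebesgue" for n by measurable
    show "AE x in lebesgue. (\<lambda>n. a x * (norm (d n x))\<^sup>2) \<longlonglongrightarrow> 0"
    proof (intro AE_I2)
      fix x
      have "(\<lambda>n. a x * (norm (d n x))\<^sup>2) \<longlonglongrightarrow> a x * (norm (v x - v x))\<^sup>2"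
        unfolding d_def by (intro tendsto_intros lim)
      then show "(\<lambda>n. a x * (norm (d n x))\<^sup>2) \<longlonglongrightarrow> 0" by simp
    qed
    show "AE x in lebesgue. norm (a x * (norm (d n x))\<^sup>2) \<le> a x * (2 * M)\<^sup>2" for n
    proof (intro AE_I2)
      fix x
      have "norm (a x * (norm (d n x))\<^sup>2) = a x * (norm (d n x))\<^sup>2"
        by (simp add: a_def abs_mult)
      also have "\<dots> \<le> a x * (2 * M)\<^sup>2"
        by (intro mult_left_mono power_mono dM) (simp_all add: a_def)
      finally show "norm (a x * (norm (d n x))\<^sup>2) \<le> a x * (2 * M)\<^sup>2" .
    qed
  qed simp
  then have I: "I \<longlonglongrightarrow> 0" by simp
  have eq: "A x *v u n x - A x *v v x = A x *v d n x" for n x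
    by (simp add: d_def matrix_vector_mult_diff_distrib)
  show "(\<lambda>n. LINT x|lebesgue. (norm (A x *v u n x - A x *v v x))\<^sup>2) \<longlonglongrightarrow> 0"
    unfolding eq
  proof (rule LIMSEQ_I)
    fix r :: real assume "r > 0"
    \<comment> \<open>This \<open>e\<close> makes the first term at most \<open>r / 2\<close> for
      all n. Only then is \<open>N\<close> chosen, since the factor \<open>e powr (1 - p)\<close>
      depends on \<open>e\<close>.\<close>
    define e where "e = r / (2 * D)"
    have e: "e > 0" using \<open>r > 0\<close> \<open>D > 0\<close> by (simp add: e_def)
    have "(\<lambda>n. e powr (1 - p) * I n) \<longlonglongrightarrow> 0"
      by (rule tendsto_mult_right_zero[OF I])
    from LIMSEQ_D[OF this, of "r / 2"] obtain N where N: "\<And>n. n \<ge> N \<Longrightarrow> norm (e powr (1 - p) * I n) < r / 2"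
      using \<open>r > 0\<close> by auto
    have "norm (LINT x|lebesgue. (norm (A x *v d n x))\<^sup>2) < r" if "n \<ge> N" for n
    proof -
      have "(LINT x|lebesgue. (norm (A x *v d n x))\<^sup>2)
          \<le> e * (LINT x|lebesgue. (norm (d n x))\<^sup>2) + e powr (1 - p) * I n"
        unfolding I_def a_def by (rule square_integrable_mult(3)[OF A p d dM e])
      moreover have "e * (LINT x|lebesgue. (norm (d n x))\<^sup>2) \<le> e * D"
        using D[of n] e by (intro mult_left_mono) auto
      moreover have "e * D = r / 2" using \<open>D > 0\<close> by (simp add: e_def)
      ultimately show ?thesis using N[OF that] by simp
    qed
    then show "\<exists>N. \<forall>n\<ge>N. norm ((LINT x|lebesgue. (norm (A x *v d n x))\<^sup>2) - 0) < r"
      by auto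
  qed
qed

section \<open>Graphs of multiplication operators and of products\<close>

lemma abs_L2_diff:
  assumes u: "u \<in> square_integrable" and v: "v \<in> square_integrable"
  shows "abs_L2 u - abs_L2 v = abs_L2 (\<lambda>x. u x - v x)"
proof -
  have "scaleC 1 (abs_L2 v) = abs_L2 v"
    using v by (simp add: scaleC.abs_eq)
  then show ?thesis
    using abs_L2_minus_scaleC(2)[OF v u, of 1] by simp
qed

lemma abs_L2_eq_iff:
  assumes "u \<in> square_integrable" "v \<in> square_integrable"
  shows "abs_L2 u = abs_L2 v \<longleftrightarrow> (AE x in lebesgue. u x = v x)"
  using Quotient_rel[OF Quotient_L2, of u v] assms by auto

text \<open>The graph admits any representative of a class. If u and v agree almost everywhere, so
  do A u and A v, hence membership can be tested on a representative given beforehand, such as the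
  bounded one from the resolvent estimate.\<close>

lemma mult_operator_iff:
  assumes A: "A \<in> borel_measurable lebesgue" and u: "u \<in> square_integrable"
  shows "(abs_L2 u, h) \<in> mult_operator A \<longleftrightarrow>
    (\<lambda>x. A x *v u x) \<in> square_integrable \<and> h = abs_L2 (\<lambda>x. A x *v u x)"
proof
  assume "(abs_L2 u, h) \<in> mult_operator A"
  then obtain v where v: "v \<in> square_integrable" "abs_L2 u = abs_L2 v"
    and Av: "(\<lambda>x. A x *v v x) \<in> square_integrable" "h = abs_L2 (\<lambda>x. A x *v v x)"
    unfolding mult_operator_def by blast
  have ae: "AE x in lebesgue. A x *v v x = A x *v u x"
    using abs_L2_eq_iff[OF u v(1)] v(2) by (auto elim: AE_mp)
  note [measurable] = borel_measurable_matrix_vector_mult[OF A square_integrableD(1)[OF u]]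
  have "integrable lebesgue (\<lambda>x. (norm (A x *v u x))\<^sup>2)"
  proof (rule integrable_cong_AE_imp[OF square_integrableD(2)[OF Av(1)]])
    show "AE x in lebesgue. (norm (A x *v v x))\<^sup>2 = (norm (A x *v u x))\<^sup>2"
      using ae by eventually_elim simp
  qed measurable
  then have Au: "(\<lambda>x. A x *v u x) \<in> square_integrable"
    by (simp add: square_integrable_def)
  then show "(\<lambda>x. A x *v u x) \<in> square_integrable \<and> h = abs_L2 (\<lambda>x. A x *v u x)"
    using abs_L2_eq_iff[OF Av(1) Au] ae Av(2) by simp
next
  assume "(\<lambda>x. A x *v u x) \<in> square_integrable \<and> h = abs_L2 (\<lambda>x. A x *v u x)"
  then show "(abs_L2 u, h) \<in> mult_operator A"
    unfolding mult_operator_def using u by blast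
qed

text \<open>The conditions on pairs in the product space are restated for components, the form in
  which they are checked for concrete graphs.\<close>

lemma linear_operator_iff:
  "linear_operator G \<longleftrightarrow> single_valued G \<and> (0, 0) \<in> G \<and>
    (\<forall>f g f' g'. (f, g) \<in> G \<longrightarrow> (f', g') \<in> G \<longrightarrow> (f + f', g + g') \<in> G) \<and>
    (\<forall>r f g. (f, g) \<in> G \<longrightarrow> (r *\<^sub>R f, r *\<^sub>R g) \<in> G) \<and>
    (\<forall>c f g. (f, g) \<in> G \<longrightarrow> (scaleC c f, scaleC c g) \<in> G)"
  unfolding linear_operator_def subspace_def Ball_def split_paired_All
  by (auto simp: zero_prod_def)

lemma linear_operator_mult_operator:
  assumes A: "A \<in> borel_measurable lebesgue"
  shows "linear_operator (mult_operator A)"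
proof -
  have elim: "\<exists>u. u \<in> square_integrable \<and> (\<lambda>x. A x *v u x) \<in> square_integrable \<and>
      f = abs_L2 u \<and> g = abs_L2 (\<lambda>x. A x *v u x)" if "(f, g) \<in> mult_operator A" for f g
    using that unfolding mult_operator_def by blast
  have intro: "(f, g) \<in> mult_operator A"
    if "u \<in> square_integrable" "(\<lambda>x. A x *v u x) \<in> square_integrable"
      "f = abs_L2 u" "g = abs_L2 (\<lambda>x. A x *v u x)" for f g u
    using that unfolding mult_operator_def by blast
  have sv: "single_valued (mult_operator A)"
  proof (rule single_valuedI)
    fix f g h assume "(f, g) \<in> mult_operator A" "(f, h) \<in> mult_operator A"
    then show "g = h"
      using elim[of f g] mult_operator_iff[OF A] by auto
  qed
  have zero: "(0, 0) \<in> mult_operator A"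
    by (rule intro[of "\<lambda>x. 0"]) (simp_all add: square_integrable_zero zero_L2_def)
  have add: "(f + f', g + g') \<in> mult_operator A"
    if fg: "(f, g) \<in> mult_operator A" "(f', g') \<in> mult_operator A" for f g f' g'
  proof -
    obtain u u' where u: "u \<in> square_integrable" "(\<lambda>x. A x *v u x) \<in> square_integrable"
        "f = abs_L2 u" "g = abs_L2 (\<lambda>x. A x *v u x)"
      and u': "u' \<in> square_integrable" "(\<lambda>x. A x *v u' x) \<in> square_integrable"
        "f' = abs_L2 u'" "g' = abs_L2 (\<lambda>x. A x *v u' x)"
      using elim[OF fg(1)] elim[OF fg(2)] by blast
    have "(\<lambda>x. A x *v (u x + u' x)) = (\<lambda>x. A x *v u x + A x *v u' x)"
      by (simp add: matrix_vector_right_distrib)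
    then show ?thesis
      using square_integrable_add[OF u(1) u'(1)] square_integrable_add[OF u(2) u'(2)] u u'
      by (intro intro[of "\<lambda>x. u x + u' x"]) (simp_all add: plus_L2.abs_eq)
  qed
  have scR: "(r *\<^sub>R f, r *\<^sub>R g) \<in> mult_operator A" if fg: "(f, g) \<in> mult_operator A" for f g r
  proof -
    obtain u where u: "u \<in> square_integrable" "(\<lambda>x. A x *v u x) \<in> square_integrable"
        "f = abs_L2 u" "g = abs_L2 (\<lambda>x. A x *v u x)"
      using elim[OF fg] by blast
    have "(\<lambda>x. A x *v (r *\<^sub>R u x)) = (\<lambda>x. r *\<^sub>R (A x *v u x))"
      by (simp add: linear_scale)
    then show ?thesis
      using square_integrable_scaleR[OF u(1), of r] square_integrable_scaleR[OF u(2), of r] u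
      by (intro intro[of "\<lambda>x. r *\<^sub>R u x"]) (simp_all add: scaleR_L2.abs_eq)
  qed
  have scC: "(scaleC c f, scaleC c g) \<in> mult_operator A" if fg: "(f, g) \<in> mult_operator A" for f g c
  proof -
    obtain u where u: "u \<in> square_integrable" "(\<lambda>x. A x *v u x) \<in> square_integrable"
        "f = abs_L2 u" "g = abs_L2 (\<lambda>x. A x *v u x)"
      using elim[OF fg] by blast
    have "(\<lambda>x. A x *v (c *s u x)) = (\<lambda>x. c *s (A x *v u x))"
      by (simp add: vector_scalar_commute)
    then show ?thesis
      using square_integrable_scaleC[OF u(1), of c] square_integrable_scaleC[OF u(2), of c] u
      by (intro intro[of "\<lambda>x. c *s u x"]) (simp_all add: scaleC.abs_eq)
  qed
  show ?thesis
    unfolding linear_operator_iff using sv zero add scR scC by blast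
qed

lemma linear_operator_relcomp:
  assumes G: "linear_operator G" and F: "linear_operator F"
  shows "linear_operator (G O F)"
  unfolding linear_operator_iff
proof (intro conjI allI impI)
  note G' = G[unfolded linear_operator_iff] and F' = F[unfolded linear_operator_iff]
  show "single_valued (G O F)" using G' F' by (intro single_valued_relcomp) blast+
  show "(0, 0) \<in> G O F" using G' F' by (intro relcompI[of 0 0]) simp_all
  fix f g assume fg: "(f, g) \<in> G O F"
  then obtain e where e: "(f, e) \<in> G" "(e, g) \<in> F" by blast
  show "(r *\<^sub>R f, r *\<^sub>R g) \<in> G O F" for r
    using e G' F' by (intro relcompI[of _ "r *\<^sub>R e"]) simp_all
  show "(scaleC c f, scaleC c g) \<in> G O F" for c
    using e G' F' by (intro relcompI[of _ "scaleC c e"]) simp_all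
  fix f' g' assume "(f', g') \<in> G O F"
  then obtain e' where "(f', e') \<in> G" "(e', g') \<in> F" by blast
  then have "(f + f', e + e') \<in> G" "(e + e', g + g') \<in> F"
    using e G' F' by simp_all
  then show "(f + f', g + g') \<in> G O F" by blast
qed

text \<open>First \<eta> is fixed as \<open>e / 4\<close>. Then the term with the length is small on
  short intervals, and so is the integral of |q|, because a primitive of |q| is continuous at
  \<open>x\<close>. None of these choices depends on \<open>n\<close>.\<close>

lemma equicontinuous_of_increment_estimate:
  fixes f :: "'i \<Rightarrow> real \<Rightarrow> 'b::real_normed_vector"
  assumes q: "locally_integrable q" and K: "K \<ge> 0" and M: "M \<ge> 0" and "e > 0"
    and inc: "\<And>n x y \<eta>. \<lbrakk>x \<le> y; \<eta> > 0\<rbrakk> \<Longrightarrow> norm (f n y - f n x) \<le>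
        \<eta> + (1 / \<eta> + K) * (y - x) + M * integral {x..y} (\<lambda>t. \<bar>q t\<bar>)"
  shows "\<exists>d>0. \<forall>n y. \<bar>y - x\<bar> < d \<longrightarrow> norm (f n y - f n x) < e"
proof -
  have qi: "(\<lambda>t. \<bar>q t\<bar>) integrable_on {s..t}" for s t
    using q unfolding locally_integrable_def absolutely_integrable_on_def by auto
  \<comment> \<open>The primitive starts at \<open>x - 1\<close> so that points on both sides of
    \<open>x\<close> are covered; the later bound \<open>d \<le> 1\<close> keeps them in its
    range.\<close>
  define Q where "Q = (\<lambda>t. integral {x - 1..t} (\<lambda>t. \<bar>q t\<bar>))"
  have Q: "integral {s..t} (\<lambda>t. \<bar>q t\<bar>) = Q t - Q s" if "x - 1 \<le> s" "s \<le> t" for s t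
    using Henstock_Kurzweil_Integration.integral_combine[OF that qi] by (simp add: Q_def)
  have "continuous_on {x - 1..x + 1} Q"
    unfolding Q_def by (rule indefinite_integral_continuous_1[OF qi])
  \<comment> \<open>Dividing by \<open>M + 1\<close> instead of \<open>M\<close> covers the case
    \<open>M = 0\<close>.\<close>
  moreover have "e / (4 * (M + 1)) > 0" using \<open>e > 0\<close> M by simp
  ultimately obtain d1 where "d1 > 0" and d1: "\<And>y. \<lbrakk>y \<in> {x - 1..x + 1}; dist y x < d1\<rbrakk> \<Longrightarrow>
      dist (Q y) (Q x) < e / (4 * (M + 1))"
    unfolding continuous_on_iff by force
  define k where "k = 1 / (e / 4) + K"
  have "k > 0" using \<open>e > 0\<close> K by (simp add: k_def add_pos_nonneg)
  define d where "d = min 1 (min d1 (e / (4 * k)))"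
  have "d > 0" using \<open>d1 > 0\<close> \<open>k > 0\<close> \<open>e > 0\<close> by (simp add: d_def)
  moreover have "norm (f n y - f n x) < e" if y: "\<bar>y - x\<bar> < d" for n y
  proof -
    define s t where "s = min x y" and "t = max x y"
    have st: "s \<le> t" "x - 1 \<le> s" "t - s = \<bar>y - x\<bar>"
      using y by (auto simp: s_def t_def d_def)
    have "norm (f n y - f n x) = norm (f n t - f n s)"
      by (auto simp: s_def t_def min_def max_def norm_minus_commute)
    also have "\<dots> \<le> e / 4 + k * (t - s) + M * (Q t - Q s)"
      using inc[OF st(1), of "e / 4" n] \<open>e > 0\<close> Q[OF st(2,1)] by (simp add: k_def)
    also have "k * (t - s) < e / 4"
      using y \<open>k > 0\<close> by (simp add: st(3) d_def field_simps)
    also have "M * (Q t - Q s) \<le> e / 4"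
    proof -
      have "Q t - Q s \<le> dist (Q y) (Q x)"
        by (auto simp: s_def t_def min_def max_def dist_real_def)
      also have "\<dots> \<le> e / (4 * (M + 1))"
        using y by (intro less_imp_le d1) (auto simp: d_def dist_real_def)
      finally have "M * (Q t - Q s) \<le> M * (e / (4 * (M + 1)))"
        using M by (rule mult_left_mono)
      also have "\<dots> \<le> e / 4"
        using M \<open>e > 0\<close> by (simp add: field_simps)
      finally show ?thesis .
    qed
    finally show ?thesis using \<open>e > 0\<close> by simp
  qed
  ultimately show ?thesis by blast
qed

section \<open>Relative compactness of the image of the unit ball\<close>

theorem lemma2:
  fixes m a p :: real and q :: "real \<Rightarrow> real"
    and A :: "real \<Rightarrow> complex^2^2" and z :: complex
  assumes "m \<ge> 0" and "a > 0"
    and "locally_integrable q" and "\<And>x. q (x + a) = q x"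
    and "p \<ge> 1" and "A \<in> Lp_matrix (2 * p)"
    and "z \<in> resolvent_set (dirac m q)"
  shows "compact_operator (resolvent (dirac m q) z O mult_operator A)"
proof -
  define R where "R = resolvent (dirac m q) z"
  define c where "c = norm z + \<bar>m\<bar>"
  have c0: "c \<ge> 0" by (simp add: c_def)
  note q = assms(3) and p = assms(5) and A = assms(6)
  have Am: "A \<in> borel_measurable lebesgue" using A by (simp add: Lp_matrix_def)
  have linR: "linear_operator R" and domR: "Domain R = UNIV"
    and "\<exists>C. \<forall>f g. (f, g) \<in> R \<longrightarrow> norm g \<le> C * norm f"
    using assms(7) by (auto simp: resolvent_set_def bounded_operator_def R_def)
  then obtain C where C: "\<And>f g. (f, g) \<in> R \<Longrightarrow> norm g \<le> C * norm f" by blast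
  note estimates = resolvent_dirac_estimates[OF q _ c_def, folded R_def]
  \<comment> \<open>Every function in the range of the resolvent has a bounded representative, so
    multiplication by \<open>A\<close> keeps it in L^2.\<close>
  have dom: "Domain (R O mult_operator A) = UNIV"
  proof (intro equalityI subset_UNIV subsetI)
    fix f :: L2
    obtain g where fg: "(f, g) \<in> R" using domR by blast
    define M where "M = sqrt ((norm f)\<^sup>2 + (2 + 2 * c) * (norm g)\<^sup>2)"
    have M: "(norm f)\<^sup>2 + (2 + 2 * c) * (norm g)\<^sup>2 \<le> M\<^sup>2" "M \<ge> 0"
      using c0 by (simp_all add: M_def)
    obtain u where u: "u \<in> square_integrable" "g = abs_L2 u" "\<And>x. norm (u x) \<le> M"
      by (rule estimates[OF fg M]) blast
    have "(g, abs_L2 (\<lambda>x. A x *v u x)) \<in> mult_operator A"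
      using mult_operator_iff[OF Am u(1)] square_integrable_mult(2)[OF A p u(1,3)] u(2) by simp
    then show "f \<in> Domain (R O mult_operator A)" using fg by blast
  qed
  have "compact (closure ((R O mult_operator A) `` cball 0 1))"
  proof (rule compact_closureI_sequentially)
    fix h :: "nat \<Rightarrow> L2" assume "\<And>n. h n \<in> (R O mult_operator A) `` cball 0 1"
    then have "\<exists>f g. norm f \<le> 1 \<and> (f, g) \<in> R \<and> (g, h n) \<in> mult_operator A" for n
      by (fastforce simp: Image_def)
    then obtain f g where f: "\<And>n. norm (f n) \<le> 1" and fg: "\<And>n. (f n, g n) \<in> R"
      and gh: "\<And>n. (g n, h n) \<in> mult_operator A"
      by metis
    \<comment> \<open>The sign of \<open>C\<close> is unknown, hence the absolute value.\<close>
    have g: "norm (g n) \<le> \<bar>C\<bar>" for n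
    proof -
      have "norm (g n) \<le> C * norm (f n)" by (rule C[OF fg])
      also have "\<dots> \<le> \<bar>C\<bar> * 1" using f by (intro mult_mono) auto
      finally show ?thesis by simp
    qed
    \<comment> \<open>This is the sup bound of the resolvent estimate for \<open>norm f = 1\<close>
      and \<open>norm g = \<bar>C\<bar>\<close>, the worst case, so it serves all n.\<close>
    define M where "M = sqrt (1 + (2 + 2 * c) * C\<^sup>2)"
    have M0: "M \<ge> 0" using c0 by (simp add: M_def)
    have f2: "(norm (f n))\<^sup>2 \<le> 1" for n
      using power_mono[OF f[of n], of 2] by simp
    have g2: "(norm (g n))\<^sup>2 \<le> C\<^sup>2" for n
      using power_mono[OF g[of n], of 2] by simp
    have M: "(norm (f n))\<^sup>2 + (2 + 2 * c) * (norm (g n))\<^sup>2 \<le> M\<^sup>2" for n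
    proof -
      have "(2 + 2 * c) * (norm (g n))\<^sup>2 \<le> (2 + 2 * c) * C\<^sup>2"
        using g2 c0 by (intro mult_left_mono) auto
      moreover have "M\<^sup>2 = 1 + (2 + 2 * c) * C\<^sup>2"
        using c0 by (simp add: M_def)
      ultimately show ?thesis using f2[of n] by linarith
    qed
    have "\<exists>u. u \<in> square_integrable \<and> g n = abs_L2 u \<and> (\<forall>x. norm (u x) \<le> M) \<and>
        (\<forall>x y \<eta>. x \<le> y \<longrightarrow> \<eta> > 0 \<longrightarrow> norm (u y - u x) \<le>
          \<eta> * (norm (f n))\<^sup>2 + (1 / \<eta> + c * M) * (y - x) + M * integral {x..y} (\<lambda>t. \<bar>q t\<bar>))" for n
      by (rule estimates[OF fg[of n] M[of n] M0]) blast
    then obtain u where u: "\<And>n. u n \<in> square_integrable" and gu: "\<And>n. g n = abs_L2 (u n)"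
      and uM: "\<And>n x. norm (u n x) \<le> M"
      and inc: "\<And>n x y \<eta>. x \<le> y \<Longrightarrow> \<eta> > 0 \<Longrightarrow> norm (u n y - u n x) \<le>
          \<eta> * (norm (f n))\<^sup>2 + (1 / \<eta> + c * M) * (y - x) + M * integral {x..y} (\<lambda>t. \<bar>q t\<bar>)"
      by metis
    have Au: "(\<lambda>x. A x *v u n x) \<in> square_integrable" "h n = abs_L2 (\<lambda>x. A x *v u n x)" for n
      using gh[of n] mult_operator_iff[OF Am u] by (simp_all add: gu)
    have uL2: "(LINT x|lebesgue. (norm (u n x))\<^sup>2) \<le> C\<^sup>2" for n
      using g2[of n] norm_abs_L2_power2[OF u] by (simp add: gu)
    obtain r v where r: "strict_mono r" and lim: "\<And>x. (\<lambda>n. u (r n) x) \<longlonglongrightarrow> v x"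
    proof (rule equicontinuous_pointwise_convergent_subsequence[OF uM])
      fix x e :: real assume "e > 0"
      show "\<exists>d>0. \<forall>n y. \<bar>y - x\<bar> < d \<longrightarrow> norm (u n y - u n x) < e"
      proof (rule equicontinuous_of_increment_estimate[OF q _ M0 \<open>e > 0\<close>])
        fix n and x y \<eta> :: real assume "x \<le> y" "\<eta> > 0"
        \<comment> \<open>Since \<open>norm (f n)\<close> is at most 1, the datum drops out and the
          bound becomes the same for all n.\<close>
        then show "norm (u n y - u n x) \<le> \<eta> + (1 / \<eta> + c * M) * (y - x) + M * integral {x..y} (\<lambda>t. \<bar>q t\<bar>)"
          using inc[of x y \<eta> n] mult_left_mono[OF f2[of n], of \<eta>] by linarith
      qed (use c0 M0 in simp)
    qed blast
    note conv = mult_tendsto_L2[OF A p u uL2 uM lim]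
    have "(\<lambda>n. norm (h (r n) - abs_L2 (\<lambda>x. A x *v v x))) \<longlonglongrightarrow> sqrt 0"
      unfolding Au(2) abs_L2_diff[OF Au(1) conv(2)]
        norm_abs_L2[OF square_integrable_diff[OF Au(1) conv(2)]]
      by (intro tendsto_real_sqrt conv(3))
    then have "(\<lambda>n. h (r n) - abs_L2 (\<lambda>x. A x *v v x)) \<longlonglongrightarrow> 0"
      unfolding real_sqrt_zero by (rule tendsto_norm_zero_cancel)
    then have "(h \<circ> r) \<longlonglongrightarrow> abs_L2 (\<lambda>x. A x *v v x)"
      unfolding o_def by (rule LIM_zero_cancel)
    with r show "\<exists>l r. strict_mono r \<and> (h \<circ> r) \<longlonglongrightarrow> l" by blast
  qed
  then show ?thesis
    using linear_operator_relcomp[OF linR linear_operator_mult_operator[OF Am]] dom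
    by (simp add: compact_operator_def R_def)
qed

end
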